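(* Let $a_1,a_2\in\mathbb{R}$ with $a_2\neq 0$. The infinitesimal point symmetries of the Fokker-Planck equation $$u_t=-a_2u-(a_2x+a_1)u_x+\tfrac12 u_{xx}$$ are generated (as a real vector space) by the vector fields $$V_1=e^{a_2t}\frac{\partial}{\partial x},\qquad V_2=u\frac{\partial}{\partial u},\qquad V_4=\frac{\partial}{\partial t},$$ $$V_3=\frac{1}{2a_2}e^{-a_2t}\frac{\partial}{\partial x}+(a_2x+a_1)\frac{u}{a_2}e^{-a_2t}\frac{\partial}{\partial u},$$ $$V_5=e^{-2a_2t}\frac{\partial}{\partial t}-(a_2x+a_1)e^{-2a_2t}\frac{\partial}{\partial x}-2(a_2x+a_1)^2e^{-2a_2t}u\frac{\partial}{\partial u},$$ $$V_6=e^{2a_2t}\frac{\partial}{\partial t}+(a_2x+a_1)e^{2a_2t}\frac{\partial}{\partial x}-a_2ue^{2a_2t}\frac{\partial}{\partial u},$$ together with the infinitely many generators $V_\alpha=\alpha(x,t)\frac{\partial}{\partial u}$, where $\alpha=\alpha(x,t)$ is any smooth solution of the same Fokker-Planck equation. That is, a smooth vector field is an infinitesimal point symmetry of the equation if and only if it equals $\sum_{i=1}^6 c_iV_i+V_\alpha$ for some $c_1,\dots,c_6\in\mathbb{R}$ and some such $\alpha$.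
   Context: Independent variables are $(x,t)\in\mathbb{R}^2$ and the dependent variable is $u\in\mathbb{R}$; subscripts denote partial derivatives. Put $\Delta=u_t+a_2u+(a_2x+a_1)u_x-\frac12u_{xx}$, regarded as a function on the second jet space with coordinates $(x,t,u,u_x,u_t,u_{xx},u_{xt},u_{tt})$. A smooth vector field $V=\xi(x,t,u)\frac{\partial}{\partial x}+\tau(x,t,u)\frac{\partial}{\partial t}+\eta(x,t,u)\frac{\partial}{\partial u}$ on $\mathbb{R}^3$ is an infinitesimal point symmetry of the equation $\Delta=0$ if $V^{(2)}(\Delta)=0$ at every point of the second jet space where $\Delta=0$. Here $V^{(2)}$ is the second prolongation $$V^{(2)}=V+\eta^x\frac{\partial}{\partial u_x}+\eta^t\frac{\partial}{\partial u_t}+\eta^{xx}\frac{\partial}{\partial u_{xx}}+\eta^{xt}\frac{\partial}{\partial u_{xt}}+\eta^{tt}\frac{\partial}{\partial u_{tt}},$$ with, for $Q=\eta-\xi u_x-\tau u_t$ and $D_x,D_t$ the total derivatives ($D_{xx}=D_xD_x$, etc.), $\eta^x=D_xQ+\xi u_{xx}+\tau u_{xt}$, $\eta^t=D_tQ+\xi u_{xt}+\tau u_{tt}$, $\eta^{xx}=D_{xx}Q+\xi u_{xxx}+\tau u_{xxt}$, $\eta^{xt}=D_{xt}Q+\xi u_{xxt}+\tau u_{xtt}$, $\eta^{tt}=D_{tt}Q+\xi u_{xtt}+\tau u_{ttt}$. *)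

theory Defs
  imports "HOL-Analysis.Analysis" "HOL-Library.Groups_Big_Fun"
begin

section \<open>Smooth maps\<close>

primrec times_differentiable ::
    "nat \<Rightarrow> ('a::euclidean_space \<Rightarrow> 'b::real_normed_vector) \<Rightarrow> bool" where
  "times_differentiable 0 f \<longleftrightarrow> continuous_on UNIV f"
| "times_differentiable (Suc k) f \<longleftrightarrow>
     (\<forall>p. f differentiable (at p)) \<and>
     (\<forall>v. times_differentiable k (\<lambda>p. frechet_derivative f (at p) v))"

definition smooth :: "('a::euclidean_space \<Rightarrow> 'b::real_normed_vector) \<Rightarrow> bool" where
  "smooth f \<longleftrightarrow> (\<forall>k. times_differentiable k f)"


section \<open>Jet coordinates and total derivatives\<close>

text \<open>
  \<open>U i j\<close> is the coordinate for the derivative of \<open>u\<close> taken \<open>i\<close> times in \<open>x\<close> and \<open>j\<close> times in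
  \<open>t\<close>: \<open>U 0 0\<close> is \<open>u\<close>, \<open>U 1 0\<close> is \<open>u\<^sub>x\<close>, \<open>U 2 1\<close> is \<open>u\<^sub>x\<^sub>x\<^sub>t\<close>.  A \<open>jet\<close> assigns values to the
  coordinates of all orders, so that the total derivatives raise the order without a change of
  type.  A function on the second jet space is one that depends only on \<open>X\<close>, \<open>T\<close> and the
  \<open>U i j\<close> with \<open>i + j \<le> 2\<close>.
\<close>

datatype coord = X | T | U nat nat

type_synonym jet = "coord \<Rightarrow> real"

definition pd :: "coord \<Rightarrow> (jet \<Rightarrow> real) \<Rightarrow> jet \<Rightarrow> real" where
  "pd c F z = deriv (\<lambda>s. F (z(c := s))) (z c)"

text \<open>
  \<open>Sum_any\<close> adds the finitely many nonzero terms; it is 0 if there are infinitely many, which does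
  not happen for a function of finitely many coordinates.
\<close>

definition Dx :: "(jet \<Rightarrow> real) \<Rightarrow> jet \<Rightarrow> real" where
  "Dx F z = pd X F z + Sum_any (\<lambda>(i, j). z (U (i + 1) j) * pd (U i j) F z)"

definition Dt :: "(jet \<Rightarrow> real) \<Rightarrow> jet \<Rightarrow> real" where
  "Dt F z = pd T F z + Sum_any (\<lambda>(i, j). z (U i (j + 1)) * pd (U i j) F z)"


section \<open>Vector fields and their second prolongation\<close>

text \<open>The vector field \<open>\<xi> \<partial>\<^sub>x + \<tau> \<partial>\<^sub>t + \<eta> \<partial>\<^sub>u\<close> is the map \<open>(x, t, u) \<mapsto> (\<xi>, \<tau>, \<eta>)\<close>.\<close>

type_synonym vfield = "real \<times> real \<times> real \<Rightarrow> real \<times> real \<times> real"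

definition xi :: "vfield \<Rightarrow> jet \<Rightarrow> real" where
  "xi V z = fst (V (z X, z T, z (U 0 0)))"

definition tau :: "vfield \<Rightarrow> jet \<Rightarrow> real" where
  "tau V z = fst (snd (V (z X, z T, z (U 0 0))))"

definition eta :: "vfield \<Rightarrow> jet \<Rightarrow> real" where
  "eta V z = snd (snd (V (z X, z T, z (U 0 0))))"

definition Q :: "vfield \<Rightarrow> jet \<Rightarrow> real" where
  "Q V z = eta V z - xi V z * z (U 1 0) - tau V z * z (U 0 1)"

definition eta_x :: "vfield \<Rightarrow> jet \<Rightarrow> real" where
  "eta_x V z = Dx (Q V) z + xi V z * z (U 2 0) + tau V z * z (U 1 1)"

definition eta_t :: "vfield \<Rightarrow> jet \<Rightarrow> real" where
  "eta_t V z = Dt (Q V) z + xi V z * z (U 1 1) + tau V z * z (U 0 2)"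

definition eta_xx :: "vfield \<Rightarrow> jet \<Rightarrow> real" where
  "eta_xx V z = Dx (Dx (Q V)) z + xi V z * z (U 3 0) + tau V z * z (U 2 1)"

definition eta_xt :: "vfield \<Rightarrow> jet \<Rightarrow> real" where
  "eta_xt V z = Dx (Dt (Q V)) z + xi V z * z (U 2 1) + tau V z * z (U 1 2)"

definition eta_tt :: "vfield \<Rightarrow> jet \<Rightarrow> real" where
  "eta_tt V z = Dt (Dt (Q V)) z + xi V z * z (U 1 2) + tau V z * z (U 0 3)"

definition prolong2 :: "vfield \<Rightarrow> (jet \<Rightarrow> real) \<Rightarrow> jet \<Rightarrow> real" where
  "prolong2 V F z =
     xi V z * pd X F z + tau V z * pd T F z + eta V z * pd (U 0 0) F z
     + eta_x V z * pd (U 1 0) F z + eta_t V z * pd (U 0 1) F z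
     + eta_xx V z * pd (U 2 0) F z + eta_xt V z * pd (U 1 1) F z
     + eta_tt V z * pd (U 0 2) F z"

text \<open>
  To be used for \<open>F\<close> on the second jet space.  The third-order coordinates cancel in \<open>eta_xx\<close>,
  \<open>eta_xt\<close> and \<open>eta_tt\<close>, and every second-order jet extends to a \<open>jet\<close>; so quantifying over all
  \<open>z\<close> amounts to quantifying over the points of the second jet space.
\<close>

definition point_symmetry :: "(jet \<Rightarrow> real) \<Rightarrow> vfield \<Rightarrow> bool" where
  "point_symmetry F V \<longleftrightarrow> smooth V \<and> (\<forall>z. F z = 0 \<longrightarrow> prolong2 V F z = 0)"


section \<open>The Fokker-Planck equation\<close>

definition fp_Delta :: "real \<Rightarrow> real \<Rightarrow> jet \<Rightarrow> real" where
  "fp_Delta a1 a2 z =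
     z (U 0 1) + a2 * z (U 0 0) + (a2 * z X + a1) * z (U 1 0) - 1/2 * z (U 2 0)"

definition fp_solution :: "real \<Rightarrow> real \<Rightarrow> (real \<times> real \<Rightarrow> real) \<Rightarrow> bool" where
  "fp_solution a1 a2 \<alpha> \<longleftrightarrow>
     (\<forall>x t. deriv (\<lambda>s. \<alpha> (x, s)) t =
        - a2 * \<alpha> (x, t) - (a2 * x + a1) * deriv (\<lambda>s. \<alpha> (s, t)) x
        + 1/2 * deriv (deriv (\<lambda>s. \<alpha> (s, t))) x)"

definition V1 :: "real \<Rightarrow> real \<Rightarrow> vfield" where
  "V1 a1 a2 = (\<lambda>(x, t, u). (exp (a2 * t), 0, 0))"

definition V2 :: "real \<Rightarrow> real \<Rightarrow> vfield" where
  "V2 a1 a2 = (\<lambda>(x, t, u). (0, 0, u))"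

definition V3 :: "real \<Rightarrow> real \<Rightarrow> vfield" where
  "V3 a1 a2 = (\<lambda>(x, t, u).
     (1 / (2 * a2) * exp (- a2 * t), 0, (a2 * x + a1) * (u / a2) * exp (- a2 * t)))"

definition V4 :: "real \<Rightarrow> real \<Rightarrow> vfield" where
  "V4 a1 a2 = (\<lambda>(x, t, u). (0, 1, 0))"

definition V5 :: "real \<Rightarrow> real \<Rightarrow> vfield" where
  "V5 a1 a2 = (\<lambda>(x, t, u).
     (- (a2 * x + a1) * exp (- 2 * a2 * t),
      exp (- 2 * a2 * t),
      - 2 * (a2 * x + a1)\<^sup>2 * exp (- 2 * a2 * t) * u))"

definition V6 :: "real \<Rightarrow> real \<Rightarrow> vfield" where
  "V6 a1 a2 = (\<lambda>(x, t, u).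
     ((a2 * x + a1) * exp (2 * a2 * t),
      exp (2 * a2 * t),
      - a2 * u * exp (2 * a2 * t)))"

definition V_alpha :: "(real \<times> real \<Rightarrow> real) \<Rightarrow> vfield" where
  "V_alpha \<alpha> = (\<lambda>(x, t, u). (0, 0, \<alpha> (x, t)))"

end

theory Submission
  imports Defs
begin

text \<open>
  The proof is Lie's algorithm.  Write \<open>b = a\<^sub>2 x + a\<^sub>1\<close>.  For \<open>V = \<xi> \<partial>\<^sub>x + \<tau> \<partial>\<^sub>t + \<eta> \<partial>\<^sub>u\<close> the condition
  \<open>V\<^sup>(\<^sup>2\<^sup>)(\<Delta>) = 0\<close> reads \<open>a\<^sub>2 \<xi> u\<^sub>x + a\<^sub>2 \<eta> + b \<eta>\<^sup>x + \<eta>\<^sup>t - \<eta>\<^sup>x\<^sup>x / 2 = 0\<close>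
  (\<open>prolong2_fp_Delta\<close>).  On \<open>\<Delta> = 0\<close> the coordinate \<open>u\<^sub>x\<^sub>x\<close> can be eliminated, and \<open>u\<^sub>x\<close>, \<open>u\<^sub>t\<close>,
  \<open>u\<^sub>x\<^sub>t\<close> are free; comparing coefficients in them gives a linear system of partial differential
  equations for \<open>\<xi>, \<tau>, \<eta>\<close> that is equivalent to \<open>V\<close> being a symmetry
  (\<open>fp_symmetry_iff_determining_equations\<close>).

  The system forces \<open>\<tau> = T(t)\<close>, \<open>\<xi> = R(t) + x T'(t) / 2\<close> and \<open>\<eta> = A(x, t) u + \<alpha>(x, t)\<close>, where
  \<open>\<alpha>\<close> solves the Fokker-Planck equation and \<open>A\<close> satisfies \<open>A\<^sub>x = a\<^sub>2 \<xi> + b \<xi>\<^sub>x - \<xi>\<^sub>t\<close> and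
  \<open>b A\<^sub>x + A\<^sub>t - A\<^sub>x\<^sub>x / 2 + a\<^sub>2 T' = 0\<close> (\<open>determining_equations_imp_normal_form\<close>).  The right-hand side
  of the first equation is affine in \<open>x\<close>, so the second is quadratic in \<open>x\<close>; its coefficients are
  ordinary differential equations in \<open>t\<close> with constant coefficients, \<open>T''' = 4 a\<^sub>2\<^sup>2 T'\<close> and, up to an
  inhomogeneity, \<open>R'' = a\<^sub>2\<^sup>2 R\<close>.  Here \<open>a\<^sub>2 \<noteq> 0\<close> makes the solutions exponentials.  They depend on six
  constants, three for \<open>T\<close>, two for \<open>R\<close> and one for \<open>A\<close>, which up to scaling are the
  coefficients of \<open>V\<^sub>1, \<dots>, V\<^sub>6\<close> (\<open>reduced_determining_system_solution\<close>).  Conversely, the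
  resulting fields satisfy the system by differentiation
  (\<open>normal_form_imp_determining_equations\<close>), and they are smooth.
\<close>


section \<open>Closure properties of smooth maps\<close>

lemma times_differentiable_SucI:
  assumes "\<And>p. (f has_derivative f' p) (at p)"
    and "\<And>v. times_differentiable k (\<lambda>p. f' p v)"
  shows "times_differentiable (Suc k) f"
proof -
  have "frechet_derivative f (at p) = f' p" for p
    using assms(1) frechet_derivative_at by metis
  with assms show ?thesis
    by (auto simp: differentiable_def)
qed

lemma times_differentiable_Suc_has_derivative:
  assumes "times_differentiable (Suc k) f"
  shows "(f has_derivative frechet_derivative f (at p)) (at p)"
  using assms frechet_derivative_works by auto

text \<open>
  Needed in the product and chain rules, where one factor of each term keeps its full order of
  differentiability while the other loses one.
\<close>

lemma times_differentiable_pred: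
  "times_differentiable (Suc k) f \<Longrightarrow> times_differentiable k f"
proof (induction k arbitrary: f)
  case 0
  then show ?case
    by (auto intro!: differentiable_imp_continuous_on simp: differentiable_on_def)
next
  case (Suc k)
  then show ?case by (metis times_differentiable.simps(2))
qed

lemma times_differentiable_const: "times_differentiable k (\<lambda>p. c)"
proof (induction k arbitrary: c)
  case (Suc k)
  show ?case by (rule times_differentiable_SucI[where f' = "\<lambda>p v. 0"]) (auto intro: Suc)
qed auto

lemma times_differentiable_bounded_linear:
  assumes "bounded_linear L" shows "times_differentiable k L"
proof (cases k)
  case 0
  then show ?thesis by (simp add: assms linear_continuous_on)
next
  case (Suc k')
  then show ?thesis using times_differentiable_SucI[of L "\<lambda>p. L" k']
    by (simp add: bounded_linear_imp_has_derivative[OF assms] times_differentiable_const)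
qed

lemma times_differentiable_linear_image:
  assumes L: "bounded_linear L"
  shows "times_differentiable k f \<Longrightarrow> times_differentiable k (\<lambda>p. L (f p))"
proof (induction k arbitrary: f)
  case 0
  then show ?case by (simp add: L bounded_linear.continuous_on)
next
  case (Suc k)
  show ?case
    by (rule times_differentiable_SucI[where f' = "\<lambda>p v. L (frechet_derivative f (at p) v)"])
      (use Suc in \<open>auto intro!: bounded_linear.has_derivative[OF L]
        times_differentiable_Suc_has_derivative[OF Suc.prems]\<close>)
qed

text \<open>
  Linearity of \<open>l\<close> is what keeps the induction inside the class of functions \<open>f (l p)\<close>: the
  derivative in direction \<open>v\<close> is again such a function, namely the derivative of \<open>f\<close> in the fixed
  direction \<open>l v\<close>.  Restrictions such as \<open>\<alpha>(x, t) = \<eta>(x, t, 0)\<close> and lifts from \<open>(x, t)\<close> to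
  \<open>(x, t, u)\<close> are of this kind.
\<close>

lemma times_differentiable_linear_substitution:
  assumes l: "bounded_linear l"
  shows "times_differentiable k f \<Longrightarrow> times_differentiable k (\<lambda>p. f (l p))"
proof (induction k arbitrary: f)
  case 0
  then show ?case
    using continuous_on_compose2[of UNIV f UNIV l] linear_continuous_on[OF l] by simp
next
  case (Suc k)
  show ?case
  proof (rule times_differentiable_SucI)
    show "((\<lambda>p. f (l p)) has_derivative (\<lambda>v. frechet_derivative f (at (l p)) (l v))) (at p)" for p
      by (rule has_derivative_compose[OF bounded_linear_imp_has_derivative[OF l]
            times_differentiable_Suc_has_derivative[OF Suc.prems]])
    show "times_differentiable k (\<lambda>p. frechet_derivative f (at (l p)) (l v))" for v
      using Suc by auto
  qed
qed

lemma times_differentiable_Pair: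
  "times_differentiable k f \<Longrightarrow> times_differentiable k g \<Longrightarrow> times_differentiable k (\<lambda>p. (f p, g p))"
proof (induction k arbitrary: f g)
  case 0
  then show ?case by (auto intro: continuous_on_Pair)
next
  case (Suc k)
  show ?case
    by (rule times_differentiable_SucI[where f' =
          "\<lambda>p v. (frechet_derivative f (at p) v, frechet_derivative g (at p) v)"])
      (use Suc in \<open>auto intro!: has_derivative_Pair times_differentiable_Suc_has_derivative\<close>)
qed

lemma times_differentiable_add:
  "times_differentiable k f \<Longrightarrow> times_differentiable k g \<Longrightarrow> times_differentiable k (\<lambda>p. f p + g p)"
proof (induction k arbitrary: f g)
  case 0
  then show ?case by (auto intro: continuous_on_add)
next
  case (Suc k)
  show ?case
    by (rule times_differentiable_SucI[where f' =
          "\<lambda>p v. frechet_derivative f (at p) v + frechet_derivative g (at p) v"])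
      (use Suc in \<open>auto intro!: has_derivative_add times_differentiable_Suc_has_derivative\<close>)
qed

lemma times_differentiable_mult:
  fixes f g :: "'a::euclidean_space \<Rightarrow> real"
  shows "times_differentiable k f \<Longrightarrow> times_differentiable k g \<Longrightarrow> times_differentiable k (\<lambda>p. f p * g p)"
proof (induction k arbitrary: f g)
  case 0
  then show ?case by (auto intro: continuous_on_mult)
next
  case (Suc k)
  show ?case
  proof (rule times_differentiable_SucI)
    show "((\<lambda>p. f p * g p) has_derivative
        (\<lambda>v. f p * frechet_derivative g (at p) v + frechet_derivative f (at p) v * g p)) (at p)" for p
      by (intro has_derivative_mult times_differentiable_Suc_has_derivative[OF Suc.prems(1)]
          times_differentiable_Suc_has_derivative[OF Suc.prems(2)])
    show "times_differentiable k
        (\<lambda>p. f p * frechet_derivative g (at p) v + frechet_derivative f (at p) v * g p)" for v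
      using Suc.prems by (intro times_differentiable_add Suc.IH)
        (auto intro: times_differentiable_pred)
  qed
qed

lemma times_differentiable_exp:
  fixes f :: "'a::euclidean_space \<Rightarrow> real"
  shows "times_differentiable k f \<Longrightarrow> times_differentiable k (\<lambda>p. exp (f p))"
proof (induction k arbitrary: f)
  case 0
  then show ?case by (auto intro: continuous_on_exp)
next
  case (Suc k)
  show ?case
  proof (rule times_differentiable_SucI)
    show "((\<lambda>p. exp (f p)) has_derivative
        (\<lambda>v. exp (f p) * frechet_derivative f (at p) v)) (at p)" for p
      by (rule has_derivative_eq_rhs, rule has_derivative_exp,
          rule times_differentiable_Suc_has_derivative[OF Suc.prems]) (simp add: mult.commute)
    show "times_differentiable k (\<lambda>p. exp (f p) * frechet_derivative f (at p) v)" for v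
      using Suc.prems by (intro times_differentiable_mult Suc.IH)
        (auto intro: times_differentiable_pred)
  qed
qed

lemma smooth_bounded_linear: "bounded_linear L \<Longrightarrow> smooth L"
  by (simp add: smooth_def times_differentiable_bounded_linear)

lemma smooth_linear_image: "bounded_linear L \<Longrightarrow> smooth f \<Longrightarrow> smooth (\<lambda>p. L (f p))"
  by (simp add: smooth_def times_differentiable_linear_image)

lemma smooth_linear_substitution: "bounded_linear l \<Longrightarrow> smooth f \<Longrightarrow> smooth (\<lambda>p. f (l p))"
  by (simp add: smooth_def times_differentiable_linear_substitution)

lemma smooth_const: "smooth (\<lambda>p. c)"
  by (simp add: smooth_def times_differentiable_const)

lemma smooth_Pair: "smooth f \<Longrightarrow> smooth g \<Longrightarrow> smooth (\<lambda>p. (f p, g p))"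
  by (simp add: smooth_def times_differentiable_Pair)

lemma smooth_add: "smooth f \<Longrightarrow> smooth g \<Longrightarrow> smooth (\<lambda>p. f p + g p)"
  by (simp add: smooth_def times_differentiable_add)

lemma smooth_mult:
  fixes f g :: "'a::euclidean_space \<Rightarrow> real"
  shows "smooth f \<Longrightarrow> smooth g \<Longrightarrow> smooth (\<lambda>p. f p * g p)"
  by (simp add: smooth_def times_differentiable_mult)

lemma smooth_diff:
  fixes f g :: "'a::euclidean_space \<Rightarrow> real"
  shows "smooth f \<Longrightarrow> smooth g \<Longrightarrow> smooth (\<lambda>p. f p - g p)"
  using smooth_add[of f "\<lambda>p. (-1) * g p"] smooth_mult[OF smooth_const, of g "-1"] by simp

lemma smooth_exp:
  fixes f :: "'a::euclidean_space \<Rightarrow> real"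
  shows "smooth f \<Longrightarrow> smooth (\<lambda>p. exp (f p))"
  by (simp add: smooth_def times_differentiable_exp)

lemma smooth_directional_derivative:
  assumes "smooth f" shows "smooth (\<lambda>p. frechet_derivative f (at p) v)"
  using assms unfolding smooth_def by (metis times_differentiable.simps(2))

lemma smooth_has_derivative:
  assumes "smooth f" shows "(f has_derivative frechet_derivative f (at p)) (at p)"
  using assms unfolding smooth_def by (metis times_differentiable_Suc_has_derivative)

lemma smooth_DERIV_along_line:
  fixes f :: "'a::euclidean_space \<Rightarrow> real"
  assumes f: "smooth f" and line: "(\<gamma> has_derivative (\<lambda>h. h *\<^sub>R v)) (at s)"
  shows "((\<lambda>s. f (\<gamma> s)) has_real_derivative frechet_derivative f (at (\<gamma> s)) v) (at s)"
proof -
  note d = smooth_has_derivative[OF f, of "\<gamma> s"]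
  have "((\<lambda>s. f (\<gamma> s)) has_derivative (\<lambda>h. frechet_derivative f (at (\<gamma> s)) (h *\<^sub>R v))) (at s)"
    by (rule has_derivative_compose[OF line d])
  moreover have "frechet_derivative f (at (\<gamma> s)) (h *\<^sub>R v) = frechet_derivative f (at (\<gamma> s)) v * h" for h
    using linear_cmul[OF has_derivative_linear[OF d], of h v] by simp
  ultimately show ?thesis by (simp add: has_field_derivative_def)
qed


section \<open>Partial derivatives\<close>

definition partial_x :: "(real \<times> real \<times> real \<Rightarrow> real) \<Rightarrow> real \<times> real \<times> real \<Rightarrow> real" where
  "partial_x f = (\<lambda>(x, t, u). deriv (\<lambda>s. f (s, t, u)) x)"

definition partial_t :: "(real \<times> real \<times> real \<Rightarrow> real) \<Rightarrow> real \<times> real \<times> real \<Rightarrow> real" where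
  "partial_t f = (\<lambda>(x, t, u). deriv (\<lambda>s. f (x, s, u)) t)"

definition partial_u :: "(real \<times> real \<times> real \<Rightarrow> real) \<Rightarrow> real \<times> real \<times> real \<Rightarrow> real" where
  "partial_u f = (\<lambda>(x, t, u). deriv (\<lambda>s. f (x, t, s)) u)"

lemma partial_x_eqI:
  assumes "\<And>x t u. ((\<lambda>s. f (s, t, u)) has_real_derivative g (x, t, u)) (at x)"
  shows "partial_x f = g"
  using assms by (auto simp: partial_x_def fun_eq_iff intro: DERIV_imp_deriv)

lemma partial_t_eqI:
  assumes "\<And>x t u. ((\<lambda>s. f (x, s, u)) has_real_derivative g (x, t, u)) (at t)"
  shows "partial_t f = g"
  using assms by (auto simp: partial_t_def fun_eq_iff intro: DERIV_imp_deriv)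

lemma partial_u_eqI:
  assumes "\<And>x t u. ((\<lambda>s. f (x, t, s)) has_real_derivative g (x, t, u)) (at u)"
  shows "partial_u f = g"
  using assms by (auto simp: partial_u_def fun_eq_iff intro: DERIV_imp_deriv)

lemma smooth_partial_x:
  assumes "smooth f"
  shows DERIV_partial_x: "((\<lambda>s. f (s, t, u)) has_real_derivative partial_x f (x, t, u)) (at x)"
    and "smooth (partial_x f)"
proof -
  have d: "((\<lambda>s. f (s, t, u)) has_real_derivative frechet_derivative f (at (x, t, u)) (1, 0, 0)) (at x)" for x t u
    by (rule smooth_DERIV_along_line[OF assms, of "\<lambda>s. (s, t, u)"])
      (auto intro!: derivative_eq_intros simp: zero_prod_def)
  then have eq: "partial_x f = (\<lambda>p. frechet_derivative f (at p) (1, 0, 0))"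
    by (intro partial_x_eqI)
  show "((\<lambda>s. f (s, t, u)) has_real_derivative partial_x f (x, t, u)) (at x)"
    by (simp add: eq d)
  show "smooth (partial_x f)"
    by (simp add: eq smooth_directional_derivative assms)
qed

lemma smooth_partial_t:
  assumes "smooth f"
  shows DERIV_partial_t: "((\<lambda>s. f (x, s, u)) has_real_derivative partial_t f (x, t, u)) (at t)"
    and "smooth (partial_t f)"
proof -
  have d: "((\<lambda>s. f (x, s, u)) has_real_derivative frechet_derivative f (at (x, t, u)) (0, 1, 0)) (at t)" for x t u
    by (rule smooth_DERIV_along_line[OF assms, of "\<lambda>s. (x, s, u)"])
      (auto intro!: derivative_eq_intros simp: zero_prod_def)
  then have eq: "partial_t f = (\<lambda>p. frechet_derivative f (at p) (0, 1, 0))"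
    by (intro partial_t_eqI)
  show "((\<lambda>s. f (x, s, u)) has_real_derivative partial_t f (x, t, u)) (at t)"
    by (simp add: eq d)
  show "smooth (partial_t f)"
    by (simp add: eq smooth_directional_derivative assms)
qed

lemma smooth_partial_u:
  assumes "smooth f"
  shows DERIV_partial_u: "((\<lambda>s. f (x, t, s)) has_real_derivative partial_u f (x, t, u)) (at u)"
    and "smooth (partial_u f)"
proof -
  have d: "((\<lambda>s. f (x, t, s)) has_real_derivative frechet_derivative f (at (x, t, u)) (0, 0, 1)) (at u)" for x t u
    by (rule smooth_DERIV_along_line[OF assms, of "\<lambda>s. (x, t, s)"])
      (auto intro!: derivative_eq_intros simp: zero_prod_def)
  then have eq: "partial_u f = (\<lambda>p. frechet_derivative f (at p) (0, 0, 1))"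
    by (intro partial_u_eqI)
  show "((\<lambda>s. f (x, t, s)) has_real_derivative partial_u f (x, t, u)) (at u)"
    by (simp add: eq d)
  show "smooth (partial_u f)"
    by (simp add: eq smooth_directional_derivative assms)
qed


section \<open>The second prolongation in coordinates\<close>

lemma pd_eqI: "((\<lambda>s. F (z(c := s))) has_real_derivative D) (at (z c)) \<Longrightarrow> pd c F z = D"
  by (simp add: pd_def DERIV_imp_deriv)

lemma pd_eq_0:
  assumes "\<And>s. F (z(c := s)) = F z" shows "pd c F z = 0"
  by (simp add: pd_def assms)

text \<open>
  A total derivative is an infinite sum over all jet coordinates; for a function that ignores the
  coordinates outside a finite set \<open>S\<close> only the terms in \<open>S\<close> survive.
\<close>

lemma Dx_finite:
  assumes "finite S" and "\<And>i j s. (i, j) \<notin> S \<Longrightarrow> F (z(U i j := s)) = F z"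
  shows "Dx F z = pd X F z + (\<Sum>(i, j)\<in>S. z (U (i + 1) j) * pd (U i j) F z)"
  unfolding Dx_def using assms(1)
  by (subst Sum_any.expand_superset[of S]) (use assms(2) in \<open>auto intro!: pd_eq_0\<close>)

lemma Dt_finite:
  assumes "finite S" and "\<And>i j s. (i, j) \<notin> S \<Longrightarrow> F (z(U i j := s)) = F z"
  shows "Dt F z = pd T F z + (\<Sum>(i, j)\<in>S. z (U i (j + 1)) * pd (U i j) F z)"
  unfolding Dt_def using assms(1)
  by (subst Sum_any.expand_superset[of S]) (use assms(2) in \<open>auto intro!: pd_eq_0\<close>)

text \<open>
  The jet-space functions below depend on a vector field only through its values at the point
  \<open>(x, t, u)\<close> under a jet.
\<close>

definition base :: "jet \<Rightarrow> real \<times> real \<times> real" where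
  "base z = (z X, z T, z (U 0 0))"

lemma Dx_Q:
  assumes sm: "smooth \<xi>" "smooth \<tau>" "smooth \<eta>"
  shows "Dx (Q (\<lambda>p. (\<xi> p, \<tau> p, \<eta> p))) z =
    partial_x \<eta> (base z) - partial_x \<xi> (base z) * z (U 1 0) - partial_x \<tau> (base z) * z (U 0 1)
    + z (U 1 0) * (partial_u \<eta> (base z) - partial_u \<xi> (base z) * z (U 1 0) - partial_u \<tau> (base z) * z (U 0 1))
    - \<xi> (base z) * z (U 2 0) - \<tau> (base z) * z (U 1 1)"
proof -
  let ?Q = "Q (\<lambda>p. (\<xi> p, \<tau> p, \<eta> p))"
  note defs = Q_def xi_def tau_def eta_def base_def
  note rules = sm[THEN DERIV_partial_x] sm[THEN DERIV_partial_u]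
  have X: "pd X ?Q z = partial_x \<eta> (base z) - partial_x \<xi> (base z) * z (U 1 0) - partial_x \<tau> (base z) * z (U 0 1)"
    by (rule pd_eqI) (auto simp: defs intro!: derivative_eq_intros rules)
  have u: "pd (U 0 0) ?Q z = partial_u \<eta> (base z) - partial_u \<xi> (base z) * z (U 1 0) - partial_u \<tau> (base z) * z (U 0 1)"
    by (rule pd_eqI) (auto simp: defs intro!: derivative_eq_intros rules)
  have p: "pd (U 1 0) ?Q z = - \<xi> (base z)"
    by (rule pd_eqI) (auto simp: defs intro!: derivative_eq_intros)
  have q: "pd (U 0 1) ?Q z = - \<tau> (base z)"
    by (rule pd_eqI) (auto simp: defs intro!: derivative_eq_intros)
  have "Dx ?Q z = pd X ?Q z + (\<Sum>(i, j)\<in>{(0, 0), (1, 0), (0, 1)}. z (U (i + 1) j) * pd (U i j) ?Q z)"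
    by (rule Dx_finite) (auto simp: defs)
  then show ?thesis by (simp add: X u p[unfolded One_nat_def] q[unfolded One_nat_def] numeral_2_eq_2)
qed

lemma Dt_Q:
  assumes sm: "smooth \<xi>" "smooth \<tau>" "smooth \<eta>"
  shows "Dt (Q (\<lambda>p. (\<xi> p, \<tau> p, \<eta> p))) z =
    partial_t \<eta> (base z) - partial_t \<xi> (base z) * z (U 1 0) - partial_t \<tau> (base z) * z (U 0 1)
    + z (U 0 1) * (partial_u \<eta> (base z) - partial_u \<xi> (base z) * z (U 1 0) - partial_u \<tau> (base z) * z (U 0 1))
    - \<xi> (base z) * z (U 1 1) - \<tau> (base z) * z (U 0 2)"
proof -
  let ?Q = "Q (\<lambda>p. (\<xi> p, \<tau> p, \<eta> p))"
  note defs = Q_def xi_def tau_def eta_def base_def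
  note rules = sm[THEN DERIV_partial_t] sm[THEN DERIV_partial_u]
  have T: "pd T ?Q z = partial_t \<eta> (base z) - partial_t \<xi> (base z) * z (U 1 0) - partial_t \<tau> (base z) * z (U 0 1)"
    by (rule pd_eqI) (auto simp: defs intro!: derivative_eq_intros rules)
  have u: "pd (U 0 0) ?Q z = partial_u \<eta> (base z) - partial_u \<xi> (base z) * z (U 1 0) - partial_u \<tau> (base z) * z (U 0 1)"
    by (rule pd_eqI) (auto simp: defs intro!: derivative_eq_intros rules)
  have p: "pd (U 1 0) ?Q z = - \<xi> (base z)"
    by (rule pd_eqI) (auto simp: defs intro!: derivative_eq_intros)
  have q: "pd (U 0 1) ?Q z = - \<tau> (base z)"
    by (rule pd_eqI) (auto simp: defs intro!: derivative_eq_intros)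
  have "Dt ?Q z = pd T ?Q z + (\<Sum>(i, j)\<in>{(0, 0), (1, 0), (0, 1)}. z (U i (j + 1)) * pd (U i j) ?Q z)"
    by (rule Dt_finite) (auto simp: defs)
  then show ?thesis by (simp add: T u p[unfolded One_nat_def] q[unfolded One_nat_def] numeral_2_eq_2)
qed

text \<open>
  Mixed second partials are kept in both orders, so that the formula follows from the chain rule
  alone; that they coincide is derived later, for functions affine in \<open>u\<close>, where it is elementary.
\<close>

lemma Dx_Dx_Q:
  assumes sm: "smooth \<xi>" "smooth \<tau>" "smooth \<eta>"
  shows "Dx (Dx (Q (\<lambda>p. (\<xi> p, \<tau> p, \<eta> p)))) z =
    (let w = base z; p = z (U 1 0); q = z (U 0 1); r = z (U 2 0); s = z (U 1 1) in
    partial_x (partial_x \<eta>) w - partial_x (partial_x \<xi>) w * p - partial_x (partial_x \<tau>) w * q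
    + p * (partial_x (partial_u \<eta>) w + partial_u (partial_x \<eta>) w
         - (partial_x (partial_u \<xi>) w + partial_u (partial_x \<xi>) w) * p
         - (partial_x (partial_u \<tau>) w + partial_u (partial_x \<tau>) w) * q)
    + p\<^sup>2 * (partial_u (partial_u \<eta>) w - partial_u (partial_u \<xi>) w * p - partial_u (partial_u \<tau>) w * q)
    + r * (partial_u \<eta> w - partial_u \<xi> w * p - partial_u \<tau> w * q)
    - 2 * r * (partial_x \<xi> w + partial_u \<xi> w * p)
    - 2 * s * (partial_x \<tau> w + partial_u \<tau> w * p)
    - \<xi> w * z (U 3 0) - \<tau> w * z (U 2 1))"
proof -
  let ?F = "\<lambda>z. partial_x \<eta> (base z) - partial_x \<xi> (base z) * z (U 1 0) - partial_x \<tau> (base z) * z (U 0 1)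
    + z (U 1 0) * (partial_u \<eta> (base z) - partial_u \<xi> (base z) * z (U 1 0) - partial_u \<tau> (base z) * z (U 0 1))
    - \<xi> (base z) * z (U 2 0) - \<tau> (base z) * z (U 1 1)"
  have DQ: "Dx (Q (\<lambda>p. (\<xi> p, \<tau> p, \<eta> p))) = ?F"
    by (rule ext) (rule Dx_Q[OF sm])
  note sx = sm[THEN smooth_partial_x(2)] and su = sm[THEN smooth_partial_u(2)]
  note rules = sm[THEN DERIV_partial_x] sm[THEN DERIV_partial_u] sx[THEN DERIV_partial_x]
    sx[THEN DERIV_partial_u] su[THEN DERIV_partial_x] su[THEN DERIV_partial_u]
  have X: "pd X ?F z = partial_x (partial_x \<eta>) (base z) - partial_x (partial_x \<xi>) (base z) * z (U 1 0)
      - partial_x (partial_x \<tau>) (base z) * z (U 0 1)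
      + z (U 1 0) * (partial_x (partial_u \<eta>) (base z) - partial_x (partial_u \<xi>) (base z) * z (U 1 0)
         - partial_x (partial_u \<tau>) (base z) * z (U 0 1))
      - partial_x \<xi> (base z) * z (U 2 0) - partial_x \<tau> (base z) * z (U 1 1)"
    by (rule pd_eqI) (auto simp: base_def intro!: derivative_eq_intros rules)
  have u: "pd (U 0 0) ?F z = partial_u (partial_x \<eta>) (base z) - partial_u (partial_x \<xi>) (base z) * z (U 1 0)
      - partial_u (partial_x \<tau>) (base z) * z (U 0 1)
      + z (U 1 0) * (partial_u (partial_u \<eta>) (base z) - partial_u (partial_u \<xi>) (base z) * z (U 1 0)
         - partial_u (partial_u \<tau>) (base z) * z (U 0 1))
      - partial_u \<xi> (base z) * z (U 2 0) - partial_u \<tau> (base z) * z (U 1 1)"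
    by (rule pd_eqI) (auto simp: base_def intro!: derivative_eq_intros rules)
  have p: "pd (U 1 0) ?F z = - partial_x \<xi> (base z) + partial_u \<eta> (base z)
      - 2 * partial_u \<xi> (base z) * z (U 1 0) - partial_u \<tau> (base z) * z (U 0 1)"
    by (rule pd_eqI) (auto simp: base_def intro!: derivative_eq_intros)
  have q: "pd (U 0 1) ?F z = - partial_x \<tau> (base z) - partial_u \<tau> (base z) * z (U 1 0)"
    by (rule pd_eqI) (auto simp: base_def intro!: derivative_eq_intros)
  have r: "pd (U 2 0) ?F z = - \<xi> (base z)"
    by (rule pd_eqI) (auto simp: base_def intro!: derivative_eq_intros)
  have s: "pd (U 1 1) ?F z = - \<tau> (base z)"
    by (rule pd_eqI) (auto simp: base_def intro!: derivative_eq_intros)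
  have "Dx ?F z = pd X ?F z + (\<Sum>(i, j)\<in>{(0, 0), (1, 0), (0, 1), (2, 0), (1, 1)}.
      z (U (i + 1) j) * pd (U i j) ?F z)"
    by (rule Dx_finite) (auto simp: base_def)
  also have "\<dots> = pd X ?F z + z (U 1 0) * pd (U 0 0) ?F z + z (U 2 0) * pd (U 1 0) ?F z
      + z (U 1 1) * pd (U 0 1) ?F z + z (U 3 0) * pd (U 2 0) ?F z + z (U 2 1) * pd (U 1 1) ?F z"
    by (simp add: numeral_2_eq_2 numeral_3_eq_3)
  finally show ?thesis
    unfolding DQ X u p q r s Let_def by algebra
qed


section \<open>The linearized symmetry condition and its determining equations\<close>

text \<open>
  \<open>\<Delta>\<close> does not involve \<open>u\<^sub>x\<^sub>t\<close> or \<open>u\<^sub>t\<^sub>t\<close>, so of the second-order coefficients only \<open>\<eta>\<^sup>x\<^sup>x\<close>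
  enters, and in it the third-order coordinates cancel.
\<close>

lemma prolong2_fp_Delta:
  assumes sm: "smooth \<xi>" "smooth \<tau>" "smooth \<eta>"
  shows "prolong2 (\<lambda>p. (\<xi> p, \<tau> p, \<eta> p)) (fp_Delta a1 a2) z =
    (let w = base z; p = z (U 1 0); q = z (U 0 1); r = z (U 2 0); s = z (U 1 1) in
    a2 * p * \<xi> w + a2 * \<eta> w
    + (a2 * z X + a1) * (partial_x \<eta> w - partial_x \<xi> w * p - partial_x \<tau> w * q
        + p * (partial_u \<eta> w - partial_u \<xi> w * p - partial_u \<tau> w * q))
    + (partial_t \<eta> w - partial_t \<xi> w * p - partial_t \<tau> w * q
        + q * (partial_u \<eta> w - partial_u \<xi> w * p - partial_u \<tau> w * q))
    - 1/2 * (partial_x (partial_x \<eta>) w - partial_x (partial_x \<xi>) w * p - partial_x (partial_x \<tau>) w * q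
        + p * (partial_x (partial_u \<eta>) w + partial_u (partial_x \<eta>) w
            - (partial_x (partial_u \<xi>) w + partial_u (partial_x \<xi>) w) * p
            - (partial_x (partial_u \<tau>) w + partial_u (partial_x \<tau>) w) * q)
        + p\<^sup>2 * (partial_u (partial_u \<eta>) w - partial_u (partial_u \<xi>) w * p
            - partial_u (partial_u \<tau>) w * q)
        + r * (partial_u \<eta> w - partial_u \<xi> w * p - partial_u \<tau> w * q)
        - 2 * r * (partial_x \<xi> w + partial_u \<xi> w * p)
        - 2 * s * (partial_x \<tau> w + partial_u \<tau> w * p)))"
proof -
  let ?F = "fp_Delta a1 a2" and ?V = "\<lambda>p. (\<xi> p, \<tau> p, \<eta> p)"
  have pds: "pd X ?F z = a2 * z (U 1 0)" "pd T ?F z = 0" "pd (U 0 0) ?F z = a2"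
    "pd (U 1 0) ?F z = a2 * z X + a1" "pd (U 0 1) ?F z = 1" "pd (U 2 0) ?F z = - 1/2"
    "pd (U 1 1) ?F z = 0" "pd (U 0 2) ?F z = 0"
    by (rule pd_eqI; auto simp: fp_Delta_def intro!: derivative_eq_intros)+
  have fields: "xi (\<lambda>p. (\<xi> p, \<tau> p, \<eta> p)) z = \<xi> (base z)"
    "tau (\<lambda>p. (\<xi> p, \<tau> p, \<eta> p)) z = \<tau> (base z)"
    "eta (\<lambda>p. (\<xi> p, \<tau> p, \<eta> p)) z = \<eta> (base z)"
    by (simp_all add: xi_def tau_def eta_def base_def)
  have eta_x: "eta_x ?V z = partial_x \<eta> (base z) - partial_x \<xi> (base z) * z (U 1 0)
      - partial_x \<tau> (base z) * z (U 0 1)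
      + z (U 1 0) * (partial_u \<eta> (base z) - partial_u \<xi> (base z) * z (U 1 0)
          - partial_u \<tau> (base z) * z (U 0 1))"
    unfolding eta_x_def fields Dx_Q[OF sm] by simp
  have eta_t: "eta_t ?V z = partial_t \<eta> (base z) - partial_t \<xi> (base z) * z (U 1 0)
      - partial_t \<tau> (base z) * z (U 0 1)
      + z (U 0 1) * (partial_u \<eta> (base z) - partial_u \<xi> (base z) * z (U 1 0)
          - partial_u \<tau> (base z) * z (U 0 1))"
    unfolding eta_t_def fields Dt_Q[OF sm] by simp
  have cancel: "k - a - b + a + b = k" for k a b :: real by simp
  have "prolong2 ?V ?F z = a2 * z (U 1 0) * \<xi> (base z) + a2 * \<eta> (base z)
      + (a2 * z X + a1) * eta_x ?V z + eta_t ?V z - 1/2 * eta_xx ?V z"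
    unfolding prolong2_def pds fields by simp
  then show ?thesis
    unfolding eta_x eta_t eta_xx_def fields Dx_Dx_Q[OF sm] Let_def cancel .
qed

lemma partial_u_eq_0_imp:
  assumes sm: "smooth f" and 0: "\<And>p. partial_u f p = 0"
  shows "f (x, t, u) = f (x, t, v)"
  using DERIV_isconst_all[of "\<lambda>s. f (x, t, s)" u v] DERIV_partial_u[OF sm, of x t] by (simp add: 0)

text \<open>
  A function that does not depend on \<open>u\<close> has an \<open>x\<close>-derivative that does not depend on \<open>u\<close>.
\<close>

lemma partial_u_partial_x_eq_0:
  assumes sm: "smooth f" and 0: "\<And>p. partial_u f p = 0"
  shows "partial_u (partial_x f) p = 0"
proof -
  obtain x t u where p: "p = (x, t, u)" by (metis prod_cases3)
  have "(\<lambda>s. f (s, t, v)) = (\<lambda>s. f (s, t, 0))" for v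
    by (rule ext) (rule partial_u_eq_0_imp[OF sm 0])
  then have "partial_x f (x, t, v) = partial_x f (x, t, 0)" for v
    unfolding partial_x_def prod.case by (rule arg_cong)
  then have "(\<lambda>v. partial_x f (x, t, v)) = (\<lambda>v. partial_x f (x, t, 0))" by blast
  then show ?thesis by (simp add: p partial_u_def)
qed

text \<open>
  The coefficients, as polynomials in \<open>p = u\<^sub>x\<close>, \<open>q = u\<^sub>t\<close> and \<open>s = u\<^sub>x\<^sub>t\<close>, of the symmetry
  condition: in order those of \<open>s\<close>, \<open>p s\<close>, \<open>p q\<close>, \<open>q\<close>, \<open>p\<^sup>2\<close>, \<open>p\<close> and \<open>1\<close>, each simplified
  by means of the preceding ones.
\<close>

definition determining_equations ::
    "real \<Rightarrow> real \<Rightarrow> (real \<times> real \<times> real \<Rightarrow> real) \<Rightarrow> (real \<times> real \<times> real \<Rightarrow> real)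
      \<Rightarrow> (real \<times> real \<times> real \<Rightarrow> real) \<Rightarrow> bool" where
  "determining_equations a1 a2 \<xi> \<tau> \<eta> \<longleftrightarrow> (\<forall>x t u. let w = (x, t, u); b = a2 * x + a1 in
     partial_x \<tau> w = 0 \<and> partial_u \<tau> w = 0 \<and> partial_u \<xi> w = 0 \<and>
     2 * partial_x \<xi> w = partial_t \<tau> w \<and> partial_u (partial_u \<eta>) w = 0 \<and>
     a2 * \<xi> w + b * partial_x \<xi> w - partial_t \<xi> w + 1/2 * partial_x (partial_x \<xi>) w
       - 1/2 * (partial_x (partial_u \<eta>) w + partial_u (partial_x \<eta>) w) = 0 \<and>
     a2 * \<eta> w + b * partial_x \<eta> w + partial_t \<eta> w - 1/2 * partial_x (partial_x \<eta>) w
       - a2 * u * (partial_u \<eta> w - 2 * partial_x \<xi> w) = 0)"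

lemma partial_zero: "partial_x (\<lambda>p. 0) = (\<lambda>p. 0)" "partial_u (\<lambda>p. 0) = (\<lambda>p. 0)"
  by (simp_all add: partial_x_def partial_u_def fun_eq_iff)

text \<open>
  Four values of \<open>p\<close> determine the cubic at \<open>q = 0\<close>; two of them, at \<open>q = 1\<close>, then determine the
  coefficients of \<open>q\<close>.
\<close>

lemma cubic_coefficients_eq_0:
  fixes c0 c1 c2 c3 d0 d1 :: real
  assumes *: "\<And>p q. c0 + c1 * p + c2 * p\<^sup>2 + c3 * p^3 + q * (d0 + d1 * p) = 0"
  shows "c0 = 0 \<and> c1 = 0 \<and> c2 = 0 \<and> d0 = 0 \<and> d1 = 0"
  using *[of 0 0] *[of 0 1] *[of 1 1] *[of 1 0] *[of "-1" 0] *[of 2 0] by simp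

text \<open>
  The shape of the hypothesis is that of the symmetry condition in its dependence on \<open>s = u\<^sub>x\<^sub>t\<close>.
\<close>

lemma slope_eq_0:
  fixes k m n :: real
  assumes "\<And>s. k - 1/2 * (m - 2 * s * n) = 0"
  shows "n = 0"
  using assms[of 0] assms[of 1] by simp

text \<open>
  The symmetry condition after \<open>r = u\<^sub>x\<^sub>x\<close> has been eliminated by means of \<open>\<Delta> = 0\<close> and the
  derivatives \<open>\<tau>\<^sub>x\<close>, \<open>\<tau>\<^sub>u\<close> have been found to vanish (the zeros on the left), sorted by powers of
  \<open>p = u\<^sub>x\<close> and \<open>q = u\<^sub>t\<close>.  Each real variable stands for the value of a partial derivative at a
  point, \<open>b\<close> for \<open>a\<^sub>2 x + a\<^sub>1\<close>.
\<close>

lemma collect_powers: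
  fixes a2 b u p q s \<xi> \<xi>x \<xi>u \<xi>t \<xi>xx \<xi>xu \<xi>ux \<xi>uu \<tau>t \<eta> \<eta>x \<eta>u \<eta>t \<eta>xx \<eta>xu \<eta>ux \<eta>uu :: real
  shows "a2 * p * \<xi> + a2 * \<eta>
    + b * (\<eta>x - \<xi>x * p - 0 * q + p * (\<eta>u - \<xi>u * p - 0 * q))
    + (\<eta>t - \<xi>t * p - \<tau>t * q + q * (\<eta>u - \<xi>u * p - 0 * q))
    - 1/2 * (\<eta>xx - \<xi>xx * p - 0 * q
        + p * (\<eta>xu + \<eta>ux - (\<xi>xu + \<xi>ux) * p - (0 + 0) * q)
        + p\<^sup>2 * (\<eta>uu - \<xi>uu * p - 0 * q)
        + (2 * (q + a2 * u + b * p)) * (\<eta>u - \<xi>u * p - 0 * q)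
        - 2 * (2 * (q + a2 * u + b * p)) * (\<xi>x + \<xi>u * p)
        - 2 * s * (0 + 0 * p)) =
    (a2 * \<eta> + b * \<eta>x + \<eta>t - 1/2 * \<eta>xx - a2 * u * (\<eta>u - 2 * \<xi>x))
    + (a2 * \<xi> + b * \<xi>x - \<xi>t + 1/2 * \<xi>xx - 1/2 * (\<eta>xu + \<eta>ux) + 3 * a2 * u * \<xi>u) * p
    + (2 * b * \<xi>u + 1/2 * (\<xi>xu + \<xi>ux) - 1/2 * \<eta>uu) * p\<^sup>2
    + 1/2 * \<xi>uu * p^3
    + q * ((2 * \<xi>x - \<tau>t) + 2 * \<xi>u * p)"
  by algebra

text \<open>
  On \<open>\<Delta> = 0\<close> the coordinate \<open>u\<^sub>x\<^sub>x\<close> is a function of the others, which remain free.  The symmetry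
  condition is then a polynomial identity in \<open>u\<^sub>x\<close>, \<open>u\<^sub>t\<close> and \<open>u\<^sub>x\<^sub>t\<close> over every point
  \<open>(x, t, u)\<close>, hence equivalent to the vanishing of its coefficients.
\<close>

lemma fp_symmetry_iff_determining_equations:
  assumes sm: "smooth \<xi>" "smooth \<tau>" "smooth \<eta>"
  shows "(\<forall>z. fp_Delta a1 a2 z = 0 \<longrightarrow> prolong2 (\<lambda>p. (\<xi> p, \<tau> p, \<eta> p)) (fp_Delta a1 a2) z = 0)
    \<longleftrightarrow> determining_equations a1 a2 \<xi> \<tau> \<eta>" (is "?L \<longleftrightarrow> ?R")
proof
  assume L: ?L
  define b where "b x = a2 * x + a1" for x
  have cond: "a2 * p * \<xi> (x, t, u) + a2 * \<eta> (x, t, u)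
    + b x * (partial_x \<eta> (x, t, u) - partial_x \<xi> (x, t, u) * p - partial_x \<tau> (x, t, u) * q
        + p * (partial_u \<eta> (x, t, u) - partial_u \<xi> (x, t, u) * p - partial_u \<tau> (x, t, u) * q))
    + (partial_t \<eta> (x, t, u) - partial_t \<xi> (x, t, u) * p - partial_t \<tau> (x, t, u) * q
        + q * (partial_u \<eta> (x, t, u) - partial_u \<xi> (x, t, u) * p - partial_u \<tau> (x, t, u) * q))
    - 1/2 * (partial_x (partial_x \<eta>) (x, t, u) - partial_x (partial_x \<xi>) (x, t, u) * p
        - partial_x (partial_x \<tau>) (x, t, u) * q
        + p * (partial_x (partial_u \<eta>) (x, t, u) + partial_u (partial_x \<eta>) (x, t, u)
            - (partial_x (partial_u \<xi>) (x, t, u) + partial_u (partial_x \<xi>) (x, t, u)) * p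
            - (partial_x (partial_u \<tau>) (x, t, u) + partial_u (partial_x \<tau>) (x, t, u)) * q)
        + p\<^sup>2 * (partial_u (partial_u \<eta>) (x, t, u) - partial_u (partial_u \<xi>) (x, t, u) * p
            - partial_u (partial_u \<tau>) (x, t, u) * q)
        + 2 * (q + a2 * u + b x * p) * (partial_u \<eta> (x, t, u) - partial_u \<xi> (x, t, u) * p - partial_u \<tau> (x, t, u) * q)
        - 2 * (2 * (q + a2 * u + b x * p)) * (partial_x \<xi> (x, t, u) + partial_u \<xi> (x, t, u) * p)
        - 2 * s * (partial_x \<tau> (x, t, u) + partial_u \<tau> (x, t, u) * p)) = 0" for x t u p q s
  proof -
    \<comment> \<open>The value of u_xx puts the jet on the hypersurface where Delta vanishes.\<close>
    define z :: jet where "z = (\<lambda>c. 0)(X := x, T := t, U 0 0 := u, U 1 0 := p, U 0 1 := q,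
      U 2 0 := 2 * (q + a2 * u + b x * p), U 1 1 := s)"
    have "fp_Delta a1 a2 z = 0"
      by (simp add: z_def fp_Delta_def b_def algebra_simps)
    with L have "prolong2 (\<lambda>p. (\<xi> p, \<tau> p, \<eta> p)) (fp_Delta a1 a2) z = 0" by blast
    then show ?thesis
      unfolding prolong2_fp_Delta[OF sm] Let_def by (simp add: z_def base_def b_def)
  qed
  \<comment> \<open>u_xt enters only through its coefficient in eta^xx.\<close>
  have "partial_x \<tau> (x, t, u) + partial_u \<tau> (x, t, u) * p = 0" for x t u p
    by (rule slope_eq_0) (rule cond[where q = 0])
  from this[of _ _ _ 0] this[of _ _ _ 1] have \<tau>0: "partial_x \<tau> = (\<lambda>p. 0)" "partial_u \<tau> = (\<lambda>p. 0)"
    by (auto simp: fun_eq_iff)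
  note cond = cond[unfolded \<tau>0 partial_zero collect_powers]
  have split: "a2 * \<eta> (x, t, u) + b x * partial_x \<eta> (x, t, u) + partial_t \<eta> (x, t, u)
        - 1/2 * partial_x (partial_x \<eta>) (x, t, u)
        - a2 * u * (partial_u \<eta> (x, t, u) - 2 * partial_x \<xi> (x, t, u)) = 0 \<and>
      a2 * \<xi> (x, t, u) + b x * partial_x \<xi> (x, t, u) - partial_t \<xi> (x, t, u)
        + 1/2 * partial_x (partial_x \<xi>) (x, t, u)
        - 1/2 * (partial_x (partial_u \<eta>) (x, t, u) + partial_u (partial_x \<eta>) (x, t, u))
        + 3 * a2 * u * partial_u \<xi> (x, t, u) = 0 \<and>
      2 * b x * partial_u \<xi> (x, t, u)
        + 1/2 * (partial_x (partial_u \<xi>) (x, t, u) + partial_u (partial_x \<xi>) (x, t, u))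
        - 1/2 * partial_u (partial_u \<eta>) (x, t, u) = 0 \<and>
      2 * partial_x \<xi> (x, t, u) - partial_t \<tau> (x, t, u) = 0 \<and>
      2 * partial_u \<xi> (x, t, u) = 0" for x t u
    by (rule cubic_coefficients_eq_0) (rule cond)
  then have \<xi>0: "partial_u \<xi> = (\<lambda>p. 0)" by (auto simp: fun_eq_iff)
  with split have "partial_u (partial_u \<eta>) (x, t, u) = 0" for x t u
    using partial_u_partial_x_eq_0[OF sm(1)] by (simp add: partial_zero)
  with split \<tau>0 \<xi>0 show ?R
    by (simp add: determining_equations_def b_def)
next
  assume R: ?R
  show ?L
  proof (intro allI impI)
    fix z assume "fp_Delta a1 a2 z = 0"
    then have r: "z (U 2 0) = 2 * (z (U 0 1) + a2 * z (U 0 0) + (a2 * z X + a1) * z (U 1 0))"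
      by (simp add: fp_Delta_def)
    have 0: "partial_x \<tau> = (\<lambda>p. 0)" "partial_u \<tau> = (\<lambda>p. 0)" "partial_u \<xi> = (\<lambda>p. 0)"
      "partial_u (partial_u \<eta>) = (\<lambda>p. 0)"
      using R by (auto simp: determining_equations_def fun_eq_iff Let_def)
    have "partial_u (partial_x \<xi>) p = 0" for p
      by (rule partial_u_partial_x_eq_0[OF sm(1)]) (simp add: 0)
    moreover have "partial_t \<tau> (base z) = 2 * partial_x \<xi> (base z)"
      "a2 * \<xi> (base z) + (a2 * z X + a1) * partial_x \<xi> (base z) - partial_t \<xi> (base z)
        + 1/2 * partial_x (partial_x \<xi>) (base z)
        - 1/2 * (partial_x (partial_u \<eta>) (base z) + partial_u (partial_x \<eta>) (base z)) = 0"
      "a2 * \<eta> (base z) + (a2 * z X + a1) * partial_x \<eta> (base z) + partial_t \<eta> (base z)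
        - 1/2 * partial_x (partial_x \<eta>) (base z)
        - a2 * z (U 0 0) * (partial_u \<eta> (base z) - 2 * partial_x \<xi> (base z)) = 0"
      using R unfolding determining_equations_def base_def by (auto simp: Let_def)
    ultimately show "prolong2 (\<lambda>p. (\<xi> p, \<tau> p, \<eta> p)) (fp_Delta a1 a2) z = 0"
      unfolding prolong2_fp_Delta[OF sm] Let_def 0(1,2) partial_zero r collect_powers
      by (simp add: 0 partial_zero)
  qed
qed


section \<open>Linear differential equations with constant coefficients\<close>

lemma DERIV_0_const:
  fixes f :: "real \<Rightarrow> real"
  assumes "\<And>x. (f has_real_derivative 0) (at x)"
  shows "f x = f 0"
  by (rule DERIV_isconst_all) (use assms in blast)

text \<open>
  \<open>f'' = k\<^sup>2 f\<close> factors as \<open>(D - k)(D + k) f = 0\<close>, so \<open>(f' + k f) e\<^sup>-\<^sup>k\<^sup>t\<close> and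
  \<open>(f' - k f) e\<^sup>k\<^sup>t\<close> are constant.
\<close>

lemma exponential_ode:
  fixes f f' :: "real \<Rightarrow> real"
  assumes k: "k \<noteq> 0"
    and f: "\<And>t. (f has_real_derivative f' t) (at t)"
    and f': "\<And>t. (f' has_real_derivative k\<^sup>2 * f t) (at t)"
  obtains A B where "\<And>t. f t = A * exp (k * t) + B * exp (- k * t)"
    and "\<And>t. f' t = k * (A * exp (k * t) - B * exp (- k * t))"
proof -
  define g where "g t = (f' t + k * f t) * exp (- k * t)" for t
  define h where "h t = (f' t - k * f t) * exp (k * t)" for t
  have dg: "(g has_real_derivative 0) (at t)" for t
    unfolding g_def by (auto intro!: derivative_eq_intros f f' simp: power2_eq_square algebra_simps)
  have dh: "(h has_real_derivative 0) (at t)" for t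
    unfolding h_def by (auto intro!: derivative_eq_intros f f' simp: power2_eq_square algebra_simps)
  have plus: "f' t + k * f t = g 0 * exp (k * t)" for t
    using DERIV_0_const[of g t, OF dg] unfolding g_def[of t] by (simp add: exp_minus field_simps)
  have minus: "f' t - k * f t = h 0 * exp (- k * t)" for t
    using DERIV_0_const[of h t, OF dh] unfolding h_def[of t] by (simp add: exp_minus field_simps)
  show ?thesis
  proof
    have e: "2 * k * f t = g 0 * exp (k * t) - h 0 * exp (- k * t)" for t
      using plus[of t] minus[of t] by linarith
    show "f t = g 0 / (2 * k) * exp (k * t) + (- h 0 / (2 * k)) * exp (- k * t)" for t
      using e[of t] k by (simp add: field_simps)
    have "2 * f' t = g 0 * exp (k * t) + h 0 * exp (- k * t)" for t
      using plus[of t] minus[of t] by linarith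
    then show "f' t = k * (g 0 / (2 * k) * exp (k * t) - (- h 0 / (2 * k)) * exp (- k * t))" for t
      using k by (simp add: field_simps)
  qed
qed

lemma DERIV_affine:
  fixes f :: "real \<Rightarrow> real"
  assumes "\<And>x. (f has_real_derivative c) (at x)"
  shows "f x = f 0 + x * c"
proof -
  have "((\<lambda>x. f x - x * c) has_real_derivative 0) (at x)" for x
    by (auto intro!: derivative_eq_intros assms)
  then have "f x - x * c = f 0 - 0 * c" by (rule DERIV_0_const)
  then show ?thesis by simp
qed


section \<open>The solutions of the determining equations\<close>

text \<open>
  The components of \<open>\<Sum> c\<^sub>i V\<^sub>i + V\<^sub>\<alpha>\<close> are \<open>\<xi>(x, t)\<close>, \<open>\<tau>(t)\<close> and \<open>\<phi>(x, t) u + \<alpha>(x, t)\<close> with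
  the following functions.
\<close>

definition general_tau :: "real \<Rightarrow> real \<Rightarrow> real \<Rightarrow> real \<Rightarrow> real \<Rightarrow> real" where
  "general_tau a2 c4 c5 c6 t = c4 + c5 * exp (- 2 * a2 * t) + c6 * exp (2 * a2 * t)"

definition general_xi :: "real \<Rightarrow> real \<Rightarrow> real \<Rightarrow> real \<Rightarrow> real \<Rightarrow> real \<Rightarrow> real \<Rightarrow> real \<Rightarrow> real" where
  "general_xi a1 a2 c1 c3 c5 c6 x t = c1 * exp (a2 * t) + c3 / (2 * a2) * exp (- a2 * t)
     + (a2 * x + a1) * (c6 * exp (2 * a2 * t) - c5 * exp (- 2 * a2 * t))"

definition general_phi :: "real \<Rightarrow> real \<Rightarrow> real \<Rightarrow> real \<Rightarrow> real \<Rightarrow> real \<Rightarrow> real \<Rightarrow> real \<Rightarrow> real" where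
  "general_phi a1 a2 c2 c3 c5 c6 x t = c2 + c3 * ((a2 * x + a1) / a2) * exp (- a2 * t)
     - 2 * c5 * (a2 * x + a1)\<^sup>2 * exp (- 2 * a2 * t) - a2 * c6 * exp (2 * a2 * t)"

lemma symmetry_combination_normal_form:
  assumes "a2 \<noteq> 0"
  shows "(\<lambda>p. c1 *\<^sub>R V1 a1 a2 p + c2 *\<^sub>R V2 a1 a2 p + c3 *\<^sub>R V3 a1 a2 p
              + c4 *\<^sub>R V4 a1 a2 p + c5 *\<^sub>R V5 a1 a2 p + c6 *\<^sub>R V6 a1 a2 p
              + V_alpha \<alpha> p) =
    (\<lambda>(x, t, u). (general_xi a1 a2 c1 c3 c5 c6 x t, general_tau a2 c4 c5 c6 t,
       general_phi a1 a2 c2 c3 c5 c6 x t * u + \<alpha> (x, t)))"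
  using assms
  by (auto simp: fun_eq_iff V1_def V2_def V3_def V4_def V5_def V6_def V_alpha_def general_xi_def
      general_tau_def general_phi_def field_simps)

lemma DERIV_general_phi_x:
  assumes "a2 \<noteq> 0"
  shows "((\<lambda>s. general_phi a1 a2 c2 c3 c5 c6 s t) has_real_derivative
    c3 * exp (- a2 * t) - 4 * a2 * c5 * (a2 * x + a1) * exp (- 2 * a2 * t)) (at x)"
  unfolding general_phi_def using assms
  by (auto intro!: derivative_eq_intros simp: field_simps)

lemma DERIV_general_phi_t:
  assumes "a2 \<noteq> 0"
  shows "((\<lambda>s. general_phi a1 a2 c2 c3 c5 c6 x s) has_real_derivative
    - c3 * (a2 * x + a1) * exp (- a2 * t) + 4 * a2 * c5 * (a2 * x + a1)\<^sup>2 * exp (- 2 * a2 * t)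
    - 2 * a2\<^sup>2 * c6 * exp (2 * a2 * t)) (at t)"
  unfolding general_phi_def using assms
  by (auto intro!: derivative_eq_intros simp: power2_eq_square field_simps)

text \<open>
  What remains of the determining equations once the dependence on \<open>u\<close> is gone, for
  \<open>\<tau> = T(t)\<close>, \<open>\<xi> = R(t) + x T'(t) / 2\<close> and \<open>\<eta>\<^sub>u = A(x, t)\<close>.  As \<open>A\<^sub>x\<close> is affine in \<open>x\<close>, the
  function \<open>A\<close> is quadratic in \<open>x\<close>, and the last equation is a polynomial of degree two in \<open>x\<close> at
  each time.  Its coefficients give \<open>T''' = 4 a\<^sub>2\<^sup>2 T'\<close>, an equation for \<open>R\<close> whose homogeneous part is
  \<open>R'' = a\<^sub>2\<^sup>2 R\<close>, and the time derivative of \<open>A\<close>, which together fix everything up to six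
  constants.
\<close>

lemma reduced_determining_system_solution:
  fixes T T1 T2 T3 R R1 R2 :: "real \<Rightarrow> real" and A A' :: "real \<Rightarrow> real \<Rightarrow> real"
  assumes a2: "a2 \<noteq> 0"
    and T: "\<And>t. (T has_real_derivative T1 t) (at t)"
    and T1: "\<And>t. (T1 has_real_derivative T2 t) (at t)"
    and T2: "\<And>t. (T2 has_real_derivative T3 t) (at t)"
    and R: "\<And>t. (R has_real_derivative R1 t) (at t)"
    and R1: "\<And>t. (R1 has_real_derivative R2 t) (at t)"
    and Ax: "\<And>x t. ((\<lambda>s. A s t) has_real_derivative
        x * (a2 * T1 t - T2 t / 2) + (a2 * R t + a1 * T1 t / 2 - R1 t)) (at x)"
    and At: "\<And>x t. ((\<lambda>s. A x s) has_real_derivative A' x t) (at t)"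
    and eq: "\<And>x t. (a2 * x + a1) * (x * (a2 * T1 t - T2 t / 2) + (a2 * R t + a1 * T1 t / 2 - R1 t))
        + A' x t - 1/2 * (a2 * T1 t - T2 t / 2) + a2 * T1 t = 0"
  obtains c1 c2 c3 c4 c5 c6 where
    "\<And>t. T t = general_tau a2 c4 c5 c6 t"
    "\<And>x t. R t + x * T1 t / 2 = general_xi a1 a2 c1 c3 c5 c6 x t"
    "\<And>x t. A x t = general_phi a1 a2 c2 c3 c5 c6 x t"
proof -
  define P where "P t = a2 * T1 t - T2 t / 2" for t
  define S where "S t = a2 * R t + a1 * T1 t / 2 - R1 t" for t
  define P' where "P' t = a2 * T2 t - T3 t / 2" for t
  define S' where "S' t = a2 * R1 t + a1 * T2 t / 2 - R2 t" for t
  have P: "(P has_real_derivative P' t) (at t)" for t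
    unfolding P_def P'_def by (auto intro!: derivative_eq_intros T1 T2)
  have S: "(S has_real_derivative S' t) (at t)" for t
    unfolding S_def S'_def by (auto intro!: derivative_eq_intros T1 R R1)
  \<comment> \<open>P and S are the coefficients of the affine function A_x, and P', S' their time derivatives.\<close>
  have A_quadratic: "A x t = A 0 t + x\<^sup>2 / 2 * P t + x * S t" for x t
  proof -
    have "((\<lambda>x. A x t - (x\<^sup>2 / 2 * P t + x * S t)) has_real_derivative 0) (at x)" for x
      by (rule derivative_eq_intros Ax refl | simp add: P_def S_def)+
    then have "A x t - (x\<^sup>2 / 2 * P t + x * S t) = A 0 t - (0\<^sup>2 / 2 * P t + 0 * S t)"
      by (rule DERIV_0_const)
    then show ?thesis by simp
  qed
  have A': "A' x t = A' 0 t + x\<^sup>2 / 2 * P' t + x * S' t" for x t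
  proof (rule DERIV_unique[OF At])
    have "((\<lambda>s. A 0 s + x\<^sup>2 / 2 * P s + x * S s) has_real_derivative
        A' 0 t + x\<^sup>2 / 2 * P' t + x * S' t) (at t)"
      by (auto intro!: derivative_eq_intros At P S)
    then show "((\<lambda>s. A x s) has_real_derivative A' 0 t + x\<^sup>2 / 2 * P' t + x * S' t) (at t)"
      using A_quadratic[of x] by simp
  qed
  have eqP: "a2 * P t + P' t / 2 = 0" and eqS: "a2 * S t + a1 * P t + S' t = 0" for t
    using eq[of 0 t] eq[of 1 t] eq[of "-1" t] A'[of 1 t] A'[of "-1" t]
    unfolding P_def[symmetric] S_def[symmetric] by (simp_all add: algebra_simps)
  have T3: "T3 t = (2 * a2)\<^sup>2 * T1 t" for t
    using eqP[of t] unfolding P_def P'_def by (simp add: power2_eq_square field_simps)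
  obtain \<alpha> \<beta> where
    T1_eq: "\<And>t. T1 t = \<alpha> * exp (2 * a2 * t) + \<beta> * exp (- (2 * a2) * t)" and
    T2_eq: "\<And>t. T2 t = 2 * a2 * (\<alpha> * exp (2 * a2 * t) - \<beta> * exp (- (2 * a2) * t))"
    using exponential_ode[of "2 * a2" T1 T2] a2 T1 T2 unfolding T3 by auto
  \<comment> \<open>a1 T' / (2 a2) is a particular solution of the inhomogeneous equation for R; it is the part of
    xi due to V5 and V6 at x = 0.  The remainder K solves the homogeneous equation.\<close>
  define K where "K t = R t - a1 * T1 t / (2 * a2)" for t
  define K1 where "K1 t = R1 t - a1 * T2 t / (2 * a2)" for t
  have "(K has_real_derivative K1 t) (at t)" for t
    unfolding K_def K1_def using a2 by (auto intro!: derivative_eq_intros R T1)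
  moreover have "(K1 has_real_derivative a2\<^sup>2 * K t) (at t)" for t
  proof -
    have "(K1 has_real_derivative R2 t - a1 * T3 t / (2 * a2)) (at t)"
      unfolding K1_def using a2 by (auto intro!: derivative_eq_intros R1 T2)
    moreover have "R2 t = a2\<^sup>2 * R t + 3/2 * a1 * a2 * T1 t"
      using eqS[of t] unfolding S_def P_def S'_def by (simp add: power2_eq_square field_simps)
    then have "R2 t - a1 * T3 t / (2 * a2) = a2\<^sup>2 * K t"
      using a2 unfolding T3 K_def by (simp add: power2_eq_square field_simps)
    ultimately show ?thesis by simp
  qed
  ultimately obtain \<kappa> \<mu> where
    K_eq: "\<And>t. K t = \<kappa> * exp (a2 * t) + \<mu> * exp (- a2 * t)" and
    K1_eq: "\<And>t. K1 t = a2 * (\<kappa> * exp (a2 * t) - \<mu> * exp (- a2 * t))"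
    using exponential_ode[of a2 K K1] a2 by metis
  \<comment> \<open>The factors undo the normalization of V3 and the integration of T' to T.\<close>
  define c1 c3 c5 c6 where c_defs: "c1 = \<kappa>" "c3 = 2 * a2 * \<mu>" "c5 = - \<beta> / (2 * a2)" "c6 = \<alpha> / (2 * a2)"
  \<comment> \<open>The constants of integration of T and A are the coefficients of V4 and V2.\<close>
  define c4 where "c4 = T 0 - c5 - c6"
  define c2 where "c2 = A 0 0 - general_phi a1 a2 0 c3 c5 c6 0 0"
  show thesis
  proof
    show "T t = general_tau a2 c4 c5 c6 t" for t
    proof -
      have "((\<lambda>t. T t - general_tau a2 c4 c5 c6 t) has_real_derivative 0) (at t)" for t
        unfolding general_tau_def c_defs using a2
        by (auto intro!: derivative_eq_intros T simp: T1_eq)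
      then have "T t - general_tau a2 c4 c5 c6 t = T 0 - general_tau a2 c4 c5 c6 0"
        by (rule DERIV_0_const)
      then show ?thesis by (simp add: general_tau_def c4_def)
    qed
    show "R t + x * T1 t / 2 = general_xi a1 a2 c1 c3 c5 c6 x t" for x t
    proof -
      have "R t = K t + a1 * T1 t / (2 * a2)" by (simp add: K_def)
      then show ?thesis using a2
        by (simp add: K_eq T1_eq general_xi_def c_defs field_simps)
    qed
    show "A x t = general_phi a1 a2 c2 c3 c5 c6 x t" for x t
    proof -
      have P_eq: "P t = - 4 * a2\<^sup>2 * c5 * exp (- 2 * a2 * t)" for t
        using a2 by (simp add: P_def T1_eq T2_eq c_defs power2_eq_square field_simps)
      have S_eq: "S t = c3 * exp (- a2 * t) - 4 * a1 * a2 * c5 * exp (- 2 * a2 * t)" for t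
      proof -
        have "S t = a2 * K t - K1 t + a1 / a2 * P t"
          using a2 by (simp add: S_def K_def K1_def P_def field_simps)
        then show ?thesis
          using a2 by (simp add: K_eq K1_eq P_eq c_defs power2_eq_square field_simps)
      qed
      have "((\<lambda>s. A s t - general_phi a1 a2 c2 c3 c5 c6 s t) has_real_derivative 0) (at s)" for s t
        by (rule DERIV_cong[OF DERIV_diff[OF Ax[folded P_def S_def] DERIV_general_phi_x[OF a2]]])
          (simp add: P_eq S_eq power2_eq_square algebra_simps)
      then have x_const: "A x t - general_phi a1 a2 c2 c3 c5 c6 x t = A 0 t - general_phi a1 a2 c2 c3 c5 c6 0 t" for x t
        by (rule DERIV_0_const)
      have A'0_raw: "A' 0 t = - a1 * S t + P t / 2 - a2 * T1 t" for t
        using eq[of 0 t] by (simp add: P_def S_def field_simps)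
      have A'0: "A' 0 t = - a1 * c3 * exp (- a2 * t) + 4 * a1\<^sup>2 * a2 * c5 * exp (- 2 * a2 * t)
          - 2 * a2\<^sup>2 * c6 * exp (2 * a2 * t)" for t
        using a2 by (simp add: A'0_raw S_eq P_eq T1_eq c_defs power2_eq_square field_simps)
      have "((\<lambda>s. A 0 s - general_phi a1 a2 c2 c3 c5 c6 0 s) has_real_derivative 0) (at s)" for s
        by (rule DERIV_cong[OF DERIV_diff[OF At DERIV_general_phi_t[OF a2]]]) (simp add: A'0)
      then have "A 0 t - general_phi a1 a2 c2 c3 c5 c6 0 t = A 0 0 - general_phi a1 a2 c2 c3 c5 c6 0 0"
        by (rule DERIV_0_const)
      with x_const[of x t] show ?thesis
        by (simp add: c2_def general_phi_def)
    qed
  qed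
qed

text \<open>
  If \<open>f\<^sub>u\<^sub>u = 0\<close> then \<open>f(x, t, u) = f(x, t, 0) + u f\<^sub>u(x, t, 0)\<close>, and the other claims follow by
  differentiating this formula.  In particular the mixed derivatives agree.
\<close>

lemma affine_in_u:
  assumes sm: "smooth f" and 0: "\<And>p. partial_u (partial_u f) p = 0"
  shows "f (x, t, u) = f (x, t, 0) + u * partial_u f (x, t, 0)"
    and "partial_u f (x, t, u) = partial_u f (x, t, 0)"
    and "partial_x f (x, t, u) = partial_x f (x, t, 0) + u * partial_x (partial_u f) (x, t, 0)"
    and "partial_t f (x, t, u) = partial_t f (x, t, 0) + u * partial_t (partial_u f) (x, t, 0)"
    and "partial_u (partial_x f) (x, t, u) = partial_x (partial_u f) (x, t, 0)"
    and "partial_x (partial_x f) (x, t, u) =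
      partial_x (partial_x f) (x, t, 0) + u * partial_x (partial_x (partial_u f)) (x, t, 0)"
proof -
  note su = smooth_partial_u(2)[OF sm] and sx = smooth_partial_x(2)[OF sm]
  show const: "partial_u f (x, t, u) = partial_u f (x, t, 0)" for x t u
    by (rule partial_u_eq_0_imp[OF su 0])
  show f: "f (x, t, u) = f (x, t, 0) + u * partial_u f (x, t, 0)" for x t u
    by (rule DERIV_affine) (use DERIV_partial_u[OF sm, of x t] const[of x t] in metis)
  show fx: "partial_x f (x, t, u) = partial_x f (x, t, 0) + u * partial_x (partial_u f) (x, t, 0)" for x t u
  proof (rule DERIV_unique[OF DERIV_partial_x[OF sm]])
    have "((\<lambda>s. f (s, t, 0) + u * partial_u f (s, t, 0)) has_real_derivative
        partial_x f (x, t, 0) + u * partial_x (partial_u f) (x, t, 0)) (at x)"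
      by (intro DERIV_add DERIV_cmult DERIV_partial_x sm su)
    then show "((\<lambda>s. f (s, t, u)) has_real_derivative
        partial_x f (x, t, 0) + u * partial_x (partial_u f) (x, t, 0)) (at x)"
      unfolding f[symmetric] .
  qed
  show "partial_t f (x, t, u) = partial_t f (x, t, 0) + u * partial_t (partial_u f) (x, t, 0)"
  proof (rule DERIV_unique[OF DERIV_partial_t[OF sm]])
    have "((\<lambda>s. f (x, s, 0) + u * partial_u f (x, s, 0)) has_real_derivative
        partial_t f (x, t, 0) + u * partial_t (partial_u f) (x, t, 0)) (at t)"
      by (intro DERIV_add DERIV_cmult DERIV_partial_t sm su)
    then show "((\<lambda>s. f (x, s, u)) has_real_derivative
        partial_t f (x, t, 0) + u * partial_t (partial_u f) (x, t, 0)) (at t)"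
      unfolding f[symmetric] .
  qed
  show "partial_u (partial_x f) (x, t, u) = partial_x (partial_u f) (x, t, 0)"
  proof (rule DERIV_unique[OF DERIV_partial_u[OF sx]])
    have "((\<lambda>v. partial_x f (x, t, 0) + v * partial_x (partial_u f) (x, t, 0)) has_real_derivative
        partial_x (partial_u f) (x, t, 0)) (at u)"
      by (auto intro!: derivative_eq_intros)
    then show "((\<lambda>v. partial_x f (x, t, v)) has_real_derivative
        partial_x (partial_u f) (x, t, 0)) (at u)"
      unfolding fx[symmetric] .
  qed
  show "partial_x (partial_x f) (x, t, u) =
      partial_x (partial_x f) (x, t, 0) + u * partial_x (partial_x (partial_u f)) (x, t, 0)"
  proof (rule DERIV_unique[OF DERIV_partial_x[OF sx]])
    have "((\<lambda>s. partial_x f (s, t, 0) + u * partial_x (partial_u f) (s, t, 0)) has_real_derivative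
        partial_x (partial_x f) (x, t, 0) + u * partial_x (partial_x (partial_u f)) (x, t, 0)) (at x)"
      by (intro DERIV_add DERIV_cmult DERIV_partial_x sx smooth_partial_x(2) su)
    then show "((\<lambda>s. partial_x f (s, t, u)) has_real_derivative
        partial_x (partial_x f) (x, t, 0) + u * partial_x (partial_x (partial_u f)) (x, t, 0)) (at x)"
      unfolding fx[symmetric] .
  qed
qed

text \<open>
  The equations \<open>\<tau>\<^sub>x = \<tau>\<^sub>u = \<xi>\<^sub>u = 0\<close>, \<open>2 \<xi>\<^sub>x = \<tau>\<^sub>t\<close> and \<open>\<eta>\<^sub>u\<^sub>u = 0\<close> fix the dependence of \<open>\<tau>\<close> on
  \<open>x, u\<close>, of \<open>\<xi>\<close> on \<open>x, u\<close> and of \<open>\<eta>\<close> on \<open>u\<close>.  The last determining equation is then affine in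
  \<open>u\<close>: its constant term says that \<open>\<alpha> = \<eta>(\<cdot>, \<cdot>, 0)\<close> solves the Fokker-Planck equation, its slope
  completes the system for the remaining functions of \<open>x\<close> and \<open>t\<close>.
\<close>

lemma determining_equations_imp_normal_form:
  assumes a2: "a2 \<noteq> 0" and sm: "smooth \<xi>" "smooth \<tau>" "smooth \<eta>"
    and det: "determining_equations a1 a2 \<xi> \<tau> \<eta>"
  obtains c1 c2 c3 c4 c5 c6 where
    "\<And>x t u. \<xi> (x, t, u) = general_xi a1 a2 c1 c3 c5 c6 x t"
    "\<And>x t u. \<tau> (x, t, u) = general_tau a2 c4 c5 c6 t"
    "\<And>x t u. \<eta> (x, t, u) = general_phi a1 a2 c2 c3 c5 c6 x t * u + \<eta> (x, t, 0)"
    "fp_solution a1 a2 (\<lambda>(x, t). \<eta> (x, t, 0))"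
proof -
  have \<tau>x: "partial_x \<tau> p = 0" and \<tau>u: "partial_u \<tau> p = 0" and \<xi>u: "partial_u \<xi> p = 0"
    and \<xi>x: "2 * partial_x \<xi> p = partial_t \<tau> p" and \<eta>uu: "partial_u (partial_u \<eta>) p = 0" for p
    using det by (cases p; simp add: determining_equations_def Let_def)+
  define T where "T t = \<tau> (0, t, 0)" for t
  define T1 where "T1 t = partial_t \<tau> (0, t, 0)" for t
  define T2 where "T2 t = partial_t (partial_t \<tau>) (0, t, 0)" for t
  define T3 where "T3 t = partial_t (partial_t (partial_t \<tau>)) (0, t, 0)" for t
  define R where "R t = \<xi> (0, t, 0)" for t
  define R1 where "R1 t = partial_t \<xi> (0, t, 0)" for t
  define R2 where "R2 t = partial_t (partial_t \<xi>) (0, t, 0)" for t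
  define A where "A x t = partial_u \<eta> (x, t, 0)" for x t
  define A' where "A' x t = partial_t (partial_u \<eta>) (x, t, 0)" for x t
  note st = smooth_partial_t(2)
  have dT: "(T has_real_derivative T1 t) (at t)" "(T1 has_real_derivative T2 t) (at t)"
    "(T2 has_real_derivative T3 t) (at t)" for t
    unfolding T_def T1_def T2_def T3_def by (intro DERIV_partial_t sm st)+
  have dR: "(R has_real_derivative R1 t) (at t)" "(R1 has_real_derivative R2 t) (at t)" for t
    unfolding R_def R1_def R2_def by (intro DERIV_partial_t sm st)+
  have \<tau>_eq: "\<tau> (x, t, u) = T t" for x t u
  proof -
    have "\<tau> (x, t, u) = \<tau> (x, t, 0)" by (rule partial_u_eq_0_imp[OF sm(2) \<tau>u])
    also have "\<dots> = T t"
      using DERIV_partial_x[OF sm(2), of t 0] unfolding T_def \<tau>x by (rule DERIV_0_const)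
    finally show ?thesis .
  qed
  have \<tau>t: "partial_t \<tau> (x, t, u) = T1 t" for x t u
    by (simp add: partial_t_def \<tau>_eq T1_def)
  have \<xi>x: "partial_x \<xi> (x, t, u) = T1 t / 2" for x t u
    using \<xi>x[of "(x, t, u)"] by (simp add: \<tau>t)
  have \<xi>_eq: "\<xi> (x, t, u) = R t + x * T1 t / 2" for x t u
  proof -
    have "\<xi> (x, t, u) = \<xi> (x, t, 0)" by (rule partial_u_eq_0_imp[OF sm(1) \<xi>u])
    also have "\<dots> = \<xi> (0, t, 0) + x * (T1 t / 2)"
      using DERIV_partial_x[OF sm(1), of t 0] unfolding \<xi>x by (rule DERIV_affine)
    finally show ?thesis by (simp add: R_def)
  qed
  have \<xi>xx: "partial_x (partial_x \<xi>) (x, t, u) = 0" for x t u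
    by (simp add: partial_x_def[of "partial_x \<xi>"] \<xi>x)
  have \<xi>t: "partial_t \<xi> (x, t, u) = R1 t + x * T2 t / 2" for x t u
  proof (rule DERIV_unique[OF DERIV_partial_t[OF sm(1)]])
    show "((\<lambda>s. \<xi> (x, s, u)) has_real_derivative R1 t + x * T2 t / 2) (at t)"
      unfolding \<xi>_eq by (auto intro!: derivative_eq_intros dT dR)
  qed
  note affine = affine_in_u[OF sm(3) \<eta>uu]
  define Ax where "Ax x t = x * (a2 * T1 t - T2 t / 2) + (a2 * R t + a1 * T1 t / 2 - R1 t)" for x t
  have \<eta>ux: "partial_x (partial_u \<eta>) (x, t, 0) = Ax x t" for x t
  proof -
    have "a2 * \<xi> (x, t, 0) + (a2 * x + a1) * partial_x \<xi> (x, t, 0) - partial_t \<xi> (x, t, 0)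
        + 1/2 * partial_x (partial_x \<xi>) (x, t, 0)
       - 1/2 * (partial_x (partial_u \<eta>) (x, t, 0) + partial_u (partial_x \<eta>) (x, t, 0)) = 0"
      using det unfolding determining_equations_def Let_def by blast
    then show ?thesis
      unfolding affine(5)[of x t 0] \<xi>_eq \<xi>x \<xi>t \<xi>xx Ax_def by (simp add: field_simps)
  qed
  have \<eta>uxx: "partial_x (partial_x (partial_u \<eta>)) (x, t, 0) = a2 * T1 t - T2 t / 2" for x t
    unfolding partial_x_def[of "partial_x (partial_u \<eta>)"] prod.case \<eta>ux Ax_def
    by (rule DERIV_imp_deriv) (auto intro!: derivative_eq_intros)
  have last: "a2 * (\<eta> (x, t, 0) + u * A x t) + (a2 * x + a1) * (partial_x \<eta> (x, t, 0) + u * Ax x t)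
      + (partial_t \<eta> (x, t, 0) + u * A' x t)
      - 1/2 * (partial_x (partial_x \<eta>) (x, t, 0) + u * (a2 * T1 t - T2 t / 2))
      - a2 * u * (A x t - T1 t) = 0" for x t u
  proof -
    have "a2 * \<eta> (x, t, u) + (a2 * x + a1) * partial_x \<eta> (x, t, u) + partial_t \<eta> (x, t, u)
        - 1/2 * partial_x (partial_x \<eta>) (x, t, u)
       - a2 * u * (partial_u \<eta> (x, t, u) - 2 * partial_x \<xi> (x, t, u)) = 0"
      using det unfolding determining_equations_def Let_def by blast
    moreover have "\<eta> (x, t, u) = \<eta> (x, t, 0) + u * A x t" "partial_u \<eta> (x, t, u) = A x t"
      "partial_x \<eta> (x, t, u) = partial_x \<eta> (x, t, 0) + u * Ax x t"
      "partial_t \<eta> (x, t, u) = partial_t \<eta> (x, t, 0) + u * A' x t"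
      "partial_x (partial_x \<eta>) (x, t, u) = partial_x (partial_x \<eta>) (x, t, 0) + u * (a2 * T1 t - T2 t / 2)"
      unfolding A_def A'_def
      using affine(1,2,3,4,6)[of x t u] by (simp_all only: \<eta>ux \<eta>uxx)
    ultimately show ?thesis by (simp only: \<xi>x) simp
  qed
  obtain c1 c2 c3 c4 c5 c6 where sol: "\<And>t. T t = general_tau a2 c4 c5 c6 t"
    "\<And>x t. R t + x * T1 t / 2 = general_xi a1 a2 c1 c3 c5 c6 x t"
    "\<And>x t. A x t = general_phi a1 a2 c2 c3 c5 c6 x t"
  proof (rule reduced_determining_system_solution[OF a2 dT dR, of A a1 A'])
    show "((\<lambda>s. A s t) has_real_derivative
        x * (a2 * T1 t - T2 t / 2) + (a2 * R t + a1 * T1 t / 2 - R1 t)) (at x)" for x t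
      using DERIV_partial_x[OF smooth_partial_u(2)[OF sm(3)], of t 0 x]
      unfolding \<eta>ux A_def Ax_def .
    show "((\<lambda>s. A x s) has_real_derivative A' x t) (at t)" for x t
      unfolding A_def A'_def by (intro DERIV_partial_t smooth_partial_u(2) sm)
    show "(a2 * x + a1) * (x * (a2 * T1 t - T2 t / 2) + (a2 * R t + a1 * T1 t / 2 - R1 t))
        + A' x t - 1/2 * (a2 * T1 t - T2 t / 2) + a2 * T1 t = 0" for x t
      using last[of x t 0] last[of x t 1] unfolding Ax_def[symmetric] by (simp add: field_simps)
  qed (rule that)
  show thesis
  proof
    show "\<xi> (x, t, u) = general_xi a1 a2 c1 c3 c5 c6 x t" for x t u
      by (simp only: \<xi>_eq sol)
    show "\<tau> (x, t, u) = general_tau a2 c4 c5 c6 t" for x t u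
      by (simp only: \<tau>_eq sol)
    show "\<eta> (x, t, u) = general_phi a1 a2 c2 c3 c5 c6 x t * u + \<eta> (x, t, 0)" for x t u
      using affine(1)[of x t u] sol(3)[of x t] by (simp add: A_def)
    have "partial_t \<eta> (x, t, 0) = - a2 * \<eta> (x, t, 0) - (a2 * x + a1) * partial_x \<eta> (x, t, 0)
        + 1/2 * partial_x (partial_x \<eta>) (x, t, 0)" for x t
      using last[of x t 0] by simp
    then show "fp_solution a1 a2 (\<lambda>(x, t). \<eta> (x, t, 0))"
      by (simp add: fp_solution_def partial_x_def partial_t_def)
  qed
qed

text \<open>
  By differentiation.  In the last equation the part free of \<open>u\<close> is the Fokker-Planck equation for
  \<open>\<alpha>\<close>, and the coefficient of \<open>u\<close> vanishes by the choice of \<open>\<phi>\<close>.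
\<close>

lemma normal_form_imp_determining_equations:
  assumes a2: "a2 \<noteq> 0" and \<alpha>: "smooth \<alpha>" "fp_solution a1 a2 \<alpha>"
  shows "determining_equations a1 a2 (\<lambda>(x, t, u). general_xi a1 a2 c1 c3 c5 c6 x t)
    (\<lambda>(x, t, u). general_tau a2 c4 c5 c6 t)
    (\<lambda>(x, t, u). general_phi a1 a2 c2 c3 c5 c6 x t * u + \<alpha> (x, t))"
    (is "determining_equations a1 a2 ?\<xi> ?\<tau> ?\<eta>")
proof -
  \<comment> \<open>The solution alpha as a function of (x, t, u): its second x-derivative in the Fokker-Planck
    equation is then an iterated partial derivative.\<close>
  define \<beta> where "\<beta> = (\<lambda>(x :: real, t :: real, u :: real). \<alpha> (x, t))"
  have "bounded_linear (\<lambda>p :: real \<times> real \<times> real. (fst p, fst (snd p)))"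
    by (intro bounded_linear_intros)
  from smooth_linear_substitution[OF this \<alpha>(1)] have \<beta>: "smooth \<beta>"
    by (simp add: \<beta>_def case_prod_unfold)
  have \<beta>_dx: "((\<lambda>s. \<alpha> (s, t)) has_real_derivative partial_x \<beta> (x, t, 0)) (at x)" for x t
    using DERIV_partial_x[OF \<beta>, of t 0 x] by (simp add: \<beta>_def)
  have \<beta>_dt: "((\<lambda>s. \<alpha> (x, s)) has_real_derivative partial_t \<beta> (x, t, 0)) (at t)" for x t
    using DERIV_partial_t[OF \<beta>, of x 0 t] by (simp add: \<beta>_def)
  note \<beta>_dxx = DERIV_partial_x[OF smooth_partial_x(2)[OF \<beta>], of _ 0]
  have \<beta>_eq: "partial_t \<beta> (x, t, 0) = - a2 * \<alpha> (x, t) - (a2 * x + a1) * partial_x \<beta> (x, t, 0)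
      + 1/2 * partial_x (partial_x \<beta>) (x, t, 0)" for x t
    using \<alpha>(2) by (simp add: fp_solution_def partial_x_def partial_t_def \<beta>_def)
  define \<phi>x where "\<phi>x = (\<lambda>x t. c3 * exp (- a2 * t) - 4 * a2 * c5 * (a2 * x + a1) * exp (- 2 * a2 * t))"
  note defs = general_tau_def general_xi_def general_phi_def \<phi>x_def
  have \<phi>: "((\<lambda>s. general_phi a1 a2 c2 c3 c5 c6 s t) has_real_derivative \<phi>x x t) (at x)" for x t
    unfolding \<phi>x_def by (rule DERIV_general_phi_x[OF a2])
  have \<phi>': "((\<lambda>s. \<phi>x s t) has_real_derivative - 4 * a2\<^sup>2 * c5 * exp (- 2 * a2 * t)) (at x)" for x t
    unfolding defs by (auto intro!: derivative_eq_intros simp: power2_eq_square)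
  have \<xi>x: "partial_x ?\<xi> = (\<lambda>(x, t, u). a2 * (c6 * exp (2 * a2 * t) - c5 * exp (- 2 * a2 * t)))"
    by (rule partial_x_eqI, unfold prod.case defs)
      (auto intro!: derivative_eq_intros simp: algebra_simps)
  have \<xi>xx: "partial_x (partial_x ?\<xi>) = (\<lambda>p. 0)"
    unfolding \<xi>x by (simp add: partial_x_def fun_eq_iff)
  have \<xi>t: "partial_t ?\<xi> = (\<lambda>(x, t, u). a2 * c1 * exp (a2 * t) - c3 / 2 * exp (- a2 * t)
     + (a2 * x + a1) * (2 * a2 * c6 * exp (2 * a2 * t) + 2 * a2 * c5 * exp (- 2 * a2 * t)))"
    by (rule partial_t_eqI, unfold prod.case defs)
      (auto intro!: derivative_eq_intros simp: field_simps a2)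
  have \<tau>t: "partial_t ?\<tau> = (\<lambda>(x, t, u). 2 * a2 * (c6 * exp (2 * a2 * t) - c5 * exp (- 2 * a2 * t)))"
    by (rule partial_t_eqI, unfold prod.case defs)
      (auto intro!: derivative_eq_intros simp: algebra_simps)
  have \<eta>x: "partial_x ?\<eta> = (\<lambda>(x, t, u). \<phi>x x t * u + partial_x \<beta> (x, t, 0))"
    by (rule partial_x_eqI, unfold prod.case)
      (auto intro!: derivative_eq_intros \<phi> \<beta>_dx)
  have \<eta>xx: "partial_x (partial_x ?\<eta>) =
      (\<lambda>(x, t, u). - 4 * a2\<^sup>2 * c5 * exp (- 2 * a2 * t) * u + partial_x (partial_x \<beta>) (x, t, 0))"
    unfolding \<eta>x
    by (rule partial_x_eqI, unfold prod.case)
      (auto intro!: derivative_eq_intros \<phi>' \<beta>_dxx)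
  have \<eta>u: "partial_u ?\<eta> = (\<lambda>(x, t, u). general_phi a1 a2 c2 c3 c5 c6 x t)"
    by (rule partial_u_eqI, unfold prod.case)
      (auto intro!: derivative_eq_intros)
  have \<eta>uu: "partial_u (partial_u ?\<eta>) = (\<lambda>p. 0)"
    unfolding \<eta>u by (simp add: partial_u_def fun_eq_iff)
  have \<eta>ux: "partial_x (partial_u ?\<eta>) = (\<lambda>(x, t, u). \<phi>x x t)"
    unfolding \<eta>u by (rule partial_x_eqI, unfold prod.case) (rule \<phi>)
  have \<eta>xu: "partial_u (partial_x ?\<eta>) = (\<lambda>(x, t, u). \<phi>x x t)"
    unfolding \<eta>x by (rule partial_u_eqI, unfold prod.case)
      (auto intro!: derivative_eq_intros)
  have \<eta>t: "partial_t ?\<eta> = (\<lambda>(x, t, u). (- c3 * (a2 * x + a1) * exp (- a2 * t)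
     + 4 * a2 * c5 * (a2 * x + a1)\<^sup>2 * exp (- 2 * a2 * t) - 2 * a2\<^sup>2 * c6 * exp (2 * a2 * t)) * u
     + partial_t \<beta> (x, t, 0))"
    by (rule partial_t_eqI, unfold prod.case)
      (auto intro!: derivative_eq_intros \<beta>_dt DERIV_general_phi_t[OF a2])
  have vanish: "partial_x ?\<tau> = (\<lambda>p. 0)" "partial_u ?\<tau> = (\<lambda>p. 0)" "partial_u ?\<xi> = (\<lambda>p. 0)"
    by (simp_all add: partial_x_def partial_u_def fun_eq_iff)
  show ?thesis
    unfolding determining_equations_def Let_def vanish \<tau>t \<eta>uu \<eta>ux \<eta>xu \<eta>xx \<eta>t \<xi>t \<xi>xx
    unfolding \<eta>u \<eta>x \<xi>x prod.case \<beta>_eq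
    using a2 by (auto simp: defs power2_eq_square field_simps)
qed

lemma smooth_normal_form:
  assumes \<alpha>: "smooth \<alpha>"
  shows "smooth (\<lambda>(x, t, u :: real). general_xi a1 a2 c1 c3 c5 c6 x t)"
    and "smooth (\<lambda>(x :: real, t, u :: real). general_tau a2 c4 c5 c6 t)"
    and "smooth (\<lambda>(x, t, u). general_phi a1 a2 c2 c3 c5 c6 x t * u + \<alpha> (x, t))"
proof -
  have coords: "smooth (\<lambda>p :: real \<times> real \<times> real. fst p)"
    "smooth (\<lambda>p :: real \<times> real \<times> real. fst (snd p))"
    "smooth (\<lambda>p :: real \<times> real \<times> real. snd (snd p))"
    by (intro smooth_bounded_linear bounded_linear_intros)+
  have "bounded_linear (\<lambda>p :: real \<times> real \<times> real. (fst p, fst (snd p)))"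
    by (intro bounded_linear_intros)
  note \<alpha>' = smooth_linear_substitution[OF this \<alpha>]
  note rules = coords \<alpha>' smooth_add smooth_diff smooth_mult smooth_exp smooth_const
  show "smooth (\<lambda>(x, t, u :: real). general_xi a1 a2 c1 c3 c5 c6 x t)"
    "smooth (\<lambda>(x :: real, t, u :: real). general_tau a2 c4 c5 c6 t)"
    "smooth (\<lambda>(x, t, u). general_phi a1 a2 c2 c3 c5 c6 x t * u + \<alpha> (x, t))"
    unfolding case_prod_unfold general_xi_def general_tau_def general_phi_def power2_eq_square divide_inverse
    by (intro rules)+
qed


section \<open>The symmetry algebra\<close>

theorem proposition2p3:
  fixes a1 a2 :: real and V :: vfield
  assumes "a2 \<noteq> 0"
  shows "point_symmetry (fp_Delta a1 a2) V \<longleftrightarrow>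
    (\<exists>c1 c2 c3 c4 c5 c6 :: real. \<exists>\<alpha> :: real \<times> real \<Rightarrow> real.
       smooth \<alpha> \<and> fp_solution a1 a2 \<alpha> \<and>
       V = (\<lambda>p. c1 *\<^sub>R V1 a1 a2 p + c2 *\<^sub>R V2 a1 a2 p + c3 *\<^sub>R V3 a1 a2 p
              + c4 *\<^sub>R V4 a1 a2 p + c5 *\<^sub>R V5 a1 a2 p + c6 *\<^sub>R V6 a1 a2 p
              + V_alpha \<alpha> p))"
  unfolding symmetry_combination_normal_form[OF assms]
proof
  assume sym: "point_symmetry (fp_Delta a1 a2) V"
  define \<xi> \<tau> \<eta> where comps: "\<xi> = (\<lambda>p. fst (V p))" "\<tau> = (\<lambda>p. fst (snd (V p)))" "\<eta> = (\<lambda>p. snd (snd (V p)))"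
  have V: "V = (\<lambda>p. (\<xi> p, \<tau> p, \<eta> p))" by (simp add: comps)
  have sm: "smooth \<xi>" "smooth \<tau>" "smooth \<eta>"
    unfolding comps using sym
    by (auto intro!: smooth_linear_image[of fst] smooth_linear_image[of snd]
        bounded_linear_fst bounded_linear_snd simp: point_symmetry_def)
  have det: "determining_equations a1 a2 \<xi> \<tau> \<eta>"
    using sym fp_symmetry_iff_determining_equations[OF sm] unfolding point_symmetry_def V by blast
  obtain c1 c2 c3 c4 c5 c6 where nf:
    "\<And>x t u. \<xi> (x, t, u) = general_xi a1 a2 c1 c3 c5 c6 x t"
    "\<And>x t u. \<tau> (x, t, u) = general_tau a2 c4 c5 c6 t"
    "\<And>x t u. \<eta> (x, t, u) = general_phi a1 a2 c2 c3 c5 c6 x t * u + \<eta> (x, t, 0)"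
    and fp: "fp_solution a1 a2 (\<lambda>(x, t). \<eta> (x, t, 0))"
    by (rule determining_equations_imp_normal_form[OF assms sm det]) (rule that)
  have "bounded_linear (\<lambda>p :: real \<times> real. (fst p, snd p, 0 :: real))"
    by (intro bounded_linear_intros)
  from smooth_linear_substitution[OF this sm(3)] have "smooth (\<lambda>(x, t). \<eta> (x, t, 0))"
    by (simp add: case_prod_unfold)
  moreover have "V = (\<lambda>(x, t, u). (general_xi a1 a2 c1 c3 c5 c6 x t, general_tau a2 c4 c5 c6 t,
       general_phi a1 a2 c2 c3 c5 c6 x t * u + (\<lambda>(x, t). \<eta> (x, t, 0)) (x, t)))"
  proof
    fix p show "V p = (\<lambda>(x, t, u). (general_xi a1 a2 c1 c3 c5 c6 x t, general_tau a2 c4 c5 c6 t,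
       general_phi a1 a2 c2 c3 c5 c6 x t * u + (\<lambda>(x, t). \<eta> (x, t, 0)) (x, t))) p"
    proof (cases p)
      case (fields x t u)
      show ?thesis
        using nf(1,2,3)[of x t u] unfolding V fields by simp
    qed
  qed
  ultimately show "\<exists>c1 c2 c3 c4 c5 c6 \<alpha>. smooth \<alpha> \<and> fp_solution a1 a2 \<alpha> \<and>
      V = (\<lambda>(x, t, u). (general_xi a1 a2 c1 c3 c5 c6 x t, general_tau a2 c4 c5 c6 t,
         general_phi a1 a2 c2 c3 c5 c6 x t * u + \<alpha> (x, t)))"
    using fp by blast
next
  assume "\<exists>c1 c2 c3 c4 c5 c6 \<alpha>. smooth \<alpha> \<and> fp_solution a1 a2 \<alpha> \<and>
      V = (\<lambda>(x, t, u). (general_xi a1 a2 c1 c3 c5 c6 x t, general_tau a2 c4 c5 c6 t,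
         general_phi a1 a2 c2 c3 c5 c6 x t * u + \<alpha> (x, t)))"
  then obtain c1 c2 c3 c4 c5 c6 \<alpha> where \<alpha>: "smooth \<alpha>" "fp_solution a1 a2 \<alpha>"
    and V: "V = (\<lambda>(x, t, u). (general_xi a1 a2 c1 c3 c5 c6 x t, general_tau a2 c4 c5 c6 t,
         general_phi a1 a2 c2 c3 c5 c6 x t * u + \<alpha> (x, t)))"
    by blast
  define \<xi> :: "real \<times> real \<times> real \<Rightarrow> real" where "\<xi> = (\<lambda>(x, t, u). general_xi a1 a2 c1 c3 c5 c6 x t)"
  define \<tau> :: "real \<times> real \<times> real \<Rightarrow> real" where "\<tau> = (\<lambda>(x, t, u). general_tau a2 c4 c5 c6 t)"
  define \<eta> where "\<eta> = (\<lambda>(x, t, u). general_phi a1 a2 c2 c3 c5 c6 x t * u + \<alpha> (x, t))"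
  have V: "V = (\<lambda>p. (\<xi> p, \<tau> p, \<eta> p))"
    by (auto simp: V \<xi>_def \<tau>_def \<eta>_def)
  have sm: "smooth \<xi>" "smooth \<tau>" "smooth \<eta>"
    unfolding \<xi>_def \<tau>_def \<eta>_def by (rule smooth_normal_form[OF \<alpha>(1)])+
  have "determining_equations a1 a2 \<xi> \<tau> \<eta>"
    unfolding \<xi>_def \<tau>_def \<eta>_def by (rule normal_form_imp_determining_equations[OF assms \<alpha>])
  then show "point_symmetry (fp_Delta a1 a2) V"
    using fp_symmetry_iff_determining_equations[OF sm] smooth_Pair[OF sm(1) smooth_Pair[OF sm(2,3)]]
    unfolding point_symmetry_def V by blast
qed

end
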